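(* Fix an integer $r \ge 1$. There exists a positive constant $C_r$ depending on $r$ alone such that the following holds for every $n \ge 2r$, every $\sigma > 0$, every $\theta^* \in \mathbb{R}^n$ and every tuning parameter $V \ge 0$ with $n^{r-1}\|D^{(r)}\theta^*\|_1 \le V$. If $Y \sim N_n(\theta^*, \sigma^2 I_n)$ and $\hat\theta^{(r)}_V$ is the constrained trend filtering estimator, then $$R(\hat{\theta}^{(r)}_V, \theta^* ) \leq C_r \max \left( \left(\frac{\sigma^2 V^{1/r}}{n} \right)^{2r/(2r + 1)} , \frac{\sigma^2}{n} \log (en)\right).$$ Also, for every $x > 0$, $$\frac{1}{n} \|\hat{\theta}^{(r)}_V - \theta^* \|^2 \leq C_r \max \left( \left(\frac{\sigma^2 V^{1/r}}{n} \right)^{2r/(2r + 1)} , \frac{\sigma^2}{n} \log (en)\right) + \frac{4 \sigma^2 x}{n}$$ with probability at least $1 - e^{-x}$.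
   Context: For $\theta\in\mathbb{R}^n$, $D^{(0)}\theta := \theta$, $D^{(1)}\theta := (\theta_2-\theta_1,\dots,\theta_n-\theta_{n-1})$, and recursively $D^{(r)}\theta := D^{(1)}(D^{(r-1)}\theta)\in\mathbb{R}^{n-r}$. $\|\cdot\|$ is the Euclidean norm and $\|\cdot\|_1$ the $\ell^1$ norm. Constrained trend filtering estimator: $\hat{\theta}^{(r)}_V := \operatorname{argmin}_{\theta \in \mathbb{R}^n}\{\frac12\|Y-\theta\|^2 : \|D^{(r)}\theta\|_1 \le V n^{1-r}\}$. Risk: $R(\hat\theta,\theta^* ) := \frac1n \mathbb{E}_{\theta^*}\|\hat\theta-\theta^*\|^2$, where $Y\sim N_n(\theta^*,\sigma^2 I_n)$. The paper assumes $n \ge 2r$ throughout. *)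

theory Defs
  imports "HOL-Probability.Probability"
begin

text \<open>
  The dimension \<open>n\<close> is quantified inside the main statement, so it cannot be a type.  A vector of
  $\mathbb{R}^n$ is an element of \<open>{..<n} \<rightarrow>\<^sub>E UNIV\<close>, the carrier of the product measure
  \<open>\<Pi>\<^sub>M i\<in>{..<n}. N i\<close>; its coordinates are indexed from \<open>0\<close>.
\<close>

abbreviation Rn :: "nat \<Rightarrow> (nat \<Rightarrow> real) set" where
  "Rn n \<equiv> {..<n} \<rightarrow>\<^sub>E UNIV"

text \<open>
  \<open>Diff\<close> acts on sequences without recording the length.  For \<open>\<theta> \<in> Rn n\<close> only the coordinates
  \<open>i < n - r\<close> of \<open>Diff r \<theta>\<close> are meaningful; they depend only on \<open>\<theta> i, \<dots>, \<theta> (i + r)\<close>.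
  Every use below is restricted to this range.
\<close>

primrec Diff :: "nat \<Rightarrow> (nat \<Rightarrow> real) \<Rightarrow> nat \<Rightarrow> real" where
  "Diff 0 \<theta> = \<theta>"
| "Diff (Suc r) \<theta> = (\<lambda>i. Diff r \<theta> (Suc i) - Diff r \<theta> i)"

definition Diff_norm1 :: "nat \<Rightarrow> nat \<Rightarrow> (nat \<Rightarrow> real) \<Rightarrow> real" where
  "Diff_norm1 n r \<theta> = (\<Sum>i<n - r. \<bar>Diff r \<theta> i\<bar>)"

definition sq_dist :: "nat \<Rightarrow> (nat \<Rightarrow> real) \<Rightarrow> (nat \<Rightarrow> real) \<Rightarrow> real" where
  "sq_dist n u v = (L2_set (\<lambda>i. u i - v i) {..<n})\<^sup>2"

text \<open>
  The objective is strictly convex and coercive on a nonempty closed convex set, so for \<open>V \<ge> 0\<close> the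
  minimiser exists and is unique in \<open>Rn n\<close>: the choice made by \<open>arg_min\<close> plays no role.
\<close>

definition trend_filter :: "nat \<Rightarrow> nat \<Rightarrow> real \<Rightarrow> (nat \<Rightarrow> real) \<Rightarrow> nat \<Rightarrow> real" where
  "trend_filter n r V Y =
    (ARG_MIN (\<lambda>\<theta>. 1 / 2 * sq_dist n Y \<theta>) \<theta>.
       \<theta> \<in> Rn n \<and> Diff_norm1 n r \<theta> \<le> V * real n powi (1 - int r))"

text \<open>
  The law $N_n(\theta, \sigma^2 I_n)$: the second argument of \<open>normal_density\<close> is the standard
  deviation.
\<close>

definition gaussian_vec :: "nat \<Rightarrow> (nat \<Rightarrow> real) \<Rightarrow> real \<Rightarrow> (nat \<Rightarrow> real) measure" where
  "gaussian_vec n \<theta> \<sigma> = (\<Pi>\<^sub>M i\<in>{..<n}. density lborel (normal_density (\<theta> i) \<sigma>))"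

definition risk ::
    "nat \<Rightarrow> real \<Rightarrow> ((nat \<Rightarrow> real) \<Rightarrow> nat \<Rightarrow> real) \<Rightarrow> (nat \<Rightarrow> real) \<Rightarrow> real" where
  "risk n \<sigma> est \<theta> = 1 / real n * (\<integral>Y. sq_dist n (est Y) \<theta> \<partial>gaussian_vec n \<theta> \<sigma>)"

end

theory Submission
  imports Defs
begin

text \<open>
  Let \<open>u\<close> be the error of the estimator and \<open>e\<close> the noise vector.  The estimator is the projection of
  \<open>Y\<close> onto a convex set that contains the true parameter, so the squared norm of \<open>u\<close> is at most the inner
  product of \<open>e\<close> and \<open>u\<close> (\<open>basic_inequality\<close>).  Moreover the variation of order \<open>r\<close> of \<open>u\<close> is at most
  \<open>2 * V / n ^ (r - 1)\<close>.  It remains to bound the inner product for vectors with this property, without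
  losing a logarithm and with a deviation term as sharp as \<open>4 * \<sigma>\<^sup>2 * x\<close>.

  Both vectors are expanded in an orthonormal basis that is adapted to the variation of order \<open>r\<close>:
  discrete multiwavelets, which are piecewise polynomials of degree less than \<open>r\<close> on dyadic blocks.
  A coarsest scale \<open>s\<close> carries all such polynomials; each block at scales 1 to \<open>s\<close> carries at most \<open>r\<close>
  detail functions, polynomial on its halves and orthogonal to the polynomials on the block itself.
  Hence the detail coefficients of \<open>u\<close> are small: summed over a scale \<open>p\<close> they are at most \<open>r\<close> times
  \<open>sqrt (2 ^ p) * (2 ^ p) ^ (r - 1)\<close> times the variation (\<open>detail_coeff_bound\<close>).

  The noise coefficients are soft-thresholded, with threshold zero on the coarse functions and
  thresholds growing linearly as the scale gets finer.  The parts below the thresholds are paired with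
  the detail coefficients of \<open>u\<close> as sup-norm against sum-norm; the geometric decay in the scale makes the
  sum comparable to its term at scale \<open>s\<close> (\<open>threshold_bias_le\<close>).  The parts above the thresholds are paired
  with the coefficients of \<open>u\<close> by \<open>2 * m * c \<le> m\<^sup>2 + c\<^sup>2\<close>, so that the squared norm of \<open>u\<close> is at most the sum \<open>Z\<close> of their
  squares plus twice the former sum (\<open>threshold_bound\<close>).  The exponential moment of \<open>Z / (4 * \<sigma>\<^sup>2)\<close> is at
  most \<open>exp (12 * r * n / 2 ^ s)\<close>, because exceeding a threshold is exponentially unlikely
  (\<open>gaussian_vec_exp_threshold\<close> and \<open>threshold_weight_sum_le\<close>).

  Together, \<open>exp ((loss - T) / (4 * \<sigma>\<^sup>2))\<close> has expectation at most 1, where \<open>T\<close> is the sum of a term of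
  order \<open>\<sigma>\<^sup>2 * n / 2 ^ s\<close> and one of order \<open>\<sigma> * (2 ^ s) powr (r - 1 / 2) * V / n ^ (r - 1)\<close>
  (\<open>exp_moment_trend_filter\<close>).  This single estimate yields the risk bound and, through Markov's
  inequality, the deviation bound with the constant 4.  Balancing the two terms of \<open>T\<close> over \<open>s\<close> gives
  the rate (\<open>scale_selection\<close>).
\<close>

section \<open>Orthonormal systems of vectors\<close>
definition ip :: "nat \<Rightarrow> (nat \<Rightarrow> real) \<Rightarrow> (nat \<Rightarrow> real) \<Rightarrow> real" where
  "ip n u v = (\<Sum>i<n. u i * v i)"

lemma ip_commute: "ip n u v = ip n v u"
  by (simp add: ip_def mult.commute)

lemma ip_cong: "(\<And>i. i < n \<Longrightarrow> u i = u' i) \<Longrightarrow> (\<And>i. i < n \<Longrightarrow> v i = v' i) \<Longrightarrow> ip n u v = ip n u' v'"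
  by (simp add: ip_def)

lemma ip_diff_right: "ip n u (\<lambda>i. v i - w i) = ip n u v - ip n u w"
  by (simp add: ip_def algebra_simps sum_subtractf)

lemma ip_diff_left: "ip n (\<lambda>i. v i - w i) u = ip n v u - ip n w u"
  by (simp add: ip_def algebra_simps sum_subtractf)

lemma ip_div_right: "ip n u (\<lambda>i. v i / c) = ip n u v / c"
  by (simp add: ip_def sum_divide_distrib)

lemma ip_sum_right: "ip n u (\<lambda>i. \<Sum>k\<in>S. c k * w k i) = (\<Sum>k\<in>S. c k * ip n u (w k))"
  unfolding ip_def sum_distrib_left by (subst sum.swap) (simp add: algebra_simps)

lemma ip_sum_left: "ip n (\<lambda>i. \<Sum>k\<in>S. c k * w k i) u = (\<Sum>k\<in>S. c k * ip n (w k) u)"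
  by (simp add: ip_commute[of n _ u] ip_sum_right)

lemma ip_self_nonneg: "0 \<le> ip n u u"
  by (simp add: ip_def sum_nonneg)

lemma ip_self_eq_0_iff: "ip n u u = 0 \<longleftrightarrow> (\<forall>i<n. u i = 0)"
  unfolding ip_def by (subst sum_nonneg_eq_0_iff) auto

lemma ip_zero_right: "ip n v v = 0 \<Longrightarrow> ip n u v = 0"
  by (simp add: ip_self_eq_0_iff) (simp add: ip_def)

text \<open>
  Zero vectors are admitted.  Gram-Schmidt applied to linearly dependent vectors then needs no
  selection of a basis, and each block can carry the same number of indices however few points
  it has.
\<close>
definition ortho_system :: "nat \<Rightarrow> 'k set \<Rightarrow> ('k \<Rightarrow> nat \<Rightarrow> real) \<Rightarrow> bool" where
  "ortho_system n W w \<longleftrightarrow> finite W \<and>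
     (\<forall>k\<in>W. \<forall>l\<in>W. k \<noteq> l \<longrightarrow> ip n (w k) (w l) = 0) \<and> (\<forall>k\<in>W. ip n (w k) (w k) \<in> {0, 1})"

lemma ip_times_norm:
  assumes "ip n e e \<in> {0, 1}" shows "ip n u e * ip n e e = ip n u e"
  using assms ip_zero_right[of n e u] by auto

lemma ortho_system_coeff:
  assumes "ortho_system n W w" "l \<in> W"
  shows "ip n (\<lambda>i. \<Sum>k\<in>W. c k * w k i) (w l) = c l * ip n (w l) (w l)"
proof -
  have "ip n (\<lambda>i. \<Sum>k\<in>W. c k * w k i) (w l) = (\<Sum>k\<in>W. if k = l then c l * ip n (w l) (w l) else 0)"
    unfolding ip_sum_left using assms by (intro sum.cong) (auto simp: ortho_system_def)
  then show ?thesis using assms by (simp add: ortho_system_def)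
qed

lemma ortho_system_norm_sum:
  assumes "ortho_system n W w"
  shows "ip n (\<lambda>i. \<Sum>k\<in>W. c k * w k i) (\<lambda>i. \<Sum>k\<in>W. c k * w k i) \<le> (\<Sum>k\<in>W. (c k)\<^sup>2)"
proof -
  have "ip n (\<lambda>i. \<Sum>k\<in>W. c k * w k i) (\<lambda>i. \<Sum>k\<in>W. c k * w k i) = (\<Sum>l\<in>W. c l * (c l * ip n (w l) (w l)))"
    by (subst ip_sum_right) (simp add: ortho_system_coeff[OF assms])
  also have "\<dots> \<le> (\<Sum>k\<in>W. (c k)\<^sup>2)"
    using assms by (intro sum_mono) (auto simp: ortho_system_def power2_eq_square)
  finally show ?thesis .
qed

text \<open>
  Spanning is expressed by the orthogonal complement being trivial.  This is the form in which
  completeness is verified for the multiwavelets, and it makes the residual of the expansion vanish.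
\<close>
lemma ortho_system_expansion:
  assumes W: "ortho_system n W w"
    and complete: "\<And>u. (\<And>k. k \<in> W \<Longrightarrow> ip n u (w k) = 0) \<Longrightarrow> \<forall>i<n. u i = 0"
  shows "ip n x u = (\<Sum>k\<in>W. ip n x (w k) * ip n u (w k))"
proof -
  define v where "v = (\<lambda>i. \<Sum>k\<in>W. ip n u (w k) * w k i)"
  have "\<forall>i<n. u i - v i = 0"
  proof (rule complete)
    fix k assume k: "k \<in> W"
    have "ip n v (w k) = ip n u (w k) * ip n (w k) (w k)"
      unfolding v_def by (rule ortho_system_coeff[OF W k])
    also have "\<dots> = ip n u (w k)"
      using W k by (intro ip_times_norm) (auto simp: ortho_system_def)
    finally show "ip n (\<lambda>i. u i - v i) (w k) = 0" by (simp add: ip_diff_left)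
  qed
  then have "ip n x u = ip n x v" by (intro ip_cong) auto
  then show ?thesis by (simp add: v_def ip_sum_right) (simp add: mult.commute)
qed

section \<open>Gram-Schmidt orthonormalisation\<close>

text \<open>
  A vector with residual zero is normalised to the zero vector, because division by zero gives zero.
\<close>
function gram_schmidt :: "nat \<Rightarrow> (nat \<Rightarrow> nat \<Rightarrow> real) \<Rightarrow> nat \<Rightarrow> nat \<Rightarrow> real" where
  "gram_schmidt n v k = (let u = (\<lambda>i. v k i - (\<Sum>j\<in>{..<k}. ip n (v k) (gram_schmidt n v j) * gram_schmidt n v j i))
               in (\<lambda>i. u i / sqrt (ip n u u)))"
  by auto
termination by (relation "Wellfounded.measure (\<lambda>(n, v, k). k)") auto

declare gram_schmidt.simps [simp del]

definition gram_schmidt_res :: "nat \<Rightarrow> (nat \<Rightarrow> nat \<Rightarrow> real) \<Rightarrow> nat \<Rightarrow> nat \<Rightarrow> real" where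
  "gram_schmidt_res n v k = (\<lambda>i. v k i - (\<Sum>j<k. ip n (v k) (gram_schmidt n v j) * gram_schmidt n v j i))"

lemma gram_schmidt_eq: "gram_schmidt n v k = (\<lambda>i. gram_schmidt_res n v k i / sqrt (ip n (gram_schmidt_res n v k) (gram_schmidt_res n v k)))"
  by (subst gram_schmidt.simps) (simp add: gram_schmidt_res_def Let_def)

lemma gram_schmidt_norm: "ip n (gram_schmidt n v k) (gram_schmidt n v k) \<in> {0, 1}"
proof -
  let ?R = "gram_schmidt_res n v k"
  have "ip n (gram_schmidt n v k) (gram_schmidt n v k) = ip n ?R ?R / (sqrt (ip n ?R ?R) * sqrt (ip n ?R ?R))"
    by (subst (1 2) gram_schmidt_eq) (simp add: ip_div_right ip_commute[of n "\<lambda>i. _ i / _"])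
  then show ?thesis using ip_self_nonneg[of n ?R] by simp
qed

lemma gram_schmidt_ortho_less: "j < k \<Longrightarrow> ip n (gram_schmidt n v j) (gram_schmidt n v k) = 0"
proof (induction k arbitrary: j rule: less_induct)
  case (less k)
  let ?e = "gram_schmidt n v"
  have "ip n (?e j) (gram_schmidt_res n v k)
      = ip n (?e j) (v k) - (\<Sum>l<k. ip n (v k) (?e l) * ip n (?e j) (?e l))"
    by (simp add: gram_schmidt_res_def ip_diff_right ip_sum_right)
  also have "(\<Sum>l<k. ip n (v k) (?e l) * ip n (?e j) (?e l))
      = (\<Sum>l<k. if l = j then ip n (v k) (?e j) * ip n (?e j) (?e j) else 0)"
  proof (intro sum.cong refl)
    fix l assume l: "l \<in> {..<k}"
    consider "l = j" | "l < j" | "j < l" by linarith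
    then show "ip n (v k) (?e l) * ip n (?e j) (?e l) = (if l = j then ip n (v k) (?e j) * ip n (?e j) (?e j) else 0)"
      using less.IH[of l j] less.IH[of j l] less.prems l ip_commute[of n "?e j" "?e l"] by cases auto
  qed
  also have "\<dots> = ip n (v k) (?e j)"
    using less.prems ip_times_norm[OF gram_schmidt_norm] by simp
  finally have "ip n (?e j) (gram_schmidt_res n v k) = 0" by (simp add: ip_commute)
  then show ?case by (subst (2) gram_schmidt_eq) (simp add: ip_div_right)
qed

lemma gram_schmidt_ortho: "j \<noteq> k \<Longrightarrow> ip n (gram_schmidt n v j) (gram_schmidt n v k) = 0"
  by (metis gram_schmidt_ortho_less ip_commute linorder_neqE_nat)

text \<open>
  The linear span of a finite family is replaced throughout by its double orthogonal complement:
  this lemma and the next one say that, for every \<open>k\<close>, the first \<open>k + 1\<close> input vectors and the first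
  \<open>k + 1\<close> output vectors have the same orthogonal complement.
\<close>
lemma perp_imp_perp_gram_schmidt:
  "(\<And>j. j \<le> k \<Longrightarrow> ip n u (v j) = 0) \<Longrightarrow> ip n u (gram_schmidt n v k) = 0"
proof (induction k rule: less_induct)
  case (less k)
  have "ip n u (gram_schmidt_res n v k) = 0"
    using less by (simp add: gram_schmidt_res_def ip_diff_right ip_sum_right)
  then show ?case by (subst gram_schmidt_eq) (simp add: ip_div_right)
qed

lemma perp_gram_schmidt_imp_perp:
  assumes "\<And>j. j \<le> k \<Longrightarrow> ip n u (gram_schmidt n v j) = 0"
  shows "ip n u (v k) = 0"
proof -
  let ?R = "gram_schmidt_res n v k"
  have "ip n u ?R = ip n u (v k)"
    using assms by (simp add: gram_schmidt_res_def ip_diff_right ip_sum_right)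
  moreover have "ip n u ?R = 0"
  proof (cases "ip n ?R ?R = 0")
    case True then show ?thesis by (rule ip_zero_right)
  next
    case False
    have "ip n u (gram_schmidt n v k) = ip n u ?R / sqrt (ip n ?R ?R)"
      by (subst gram_schmidt_eq) (simp add: ip_div_right)
    then show ?thesis using False assms[of k] by simp
  qed
  ultimately show ?thesis by simp
qed

lemma gram_schmidt_zero_at: "(\<And>j. j \<le> k \<Longrightarrow> v j i = 0) \<Longrightarrow> gram_schmidt n v k i = 0"
proof (induction k rule: less_induct)
  case (less k)
  have "gram_schmidt_res n v k i = 0" using less by (simp add: gram_schmidt_res_def)
  then show ?case by (subst gram_schmidt_eq) simp
qed

section \<open>Discrete multiwavelets on dyadic blocks\<close>

text \<open>
  Binomial coefficients replace monomials as a basis of the polynomials of degree less than \<open>r\<close>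
  since the difference operator merely shifts their lower index.
\<close>
definition block_binomial :: "nat \<Rightarrow> nat \<Rightarrow> nat \<Rightarrow> nat \<Rightarrow> real" where
  "block_binomial p m a i = (if i div 2 ^ p = m then real (i choose a) else 0)"

text \<open>
  The polynomials on the block \<open>m\<close> of scale \<open>p\<close>, followed by those on its left half.  The right half
  is covered as well, by subtraction.  After orthonormalisation the first \<open>r\<close> vectors describe the
  polynomials on the block, and the next \<open>r\<close> what is gained by splitting it.
\<close>
definition block_flag :: "nat \<Rightarrow> nat \<Rightarrow> nat \<Rightarrow> nat \<Rightarrow> nat \<Rightarrow> real" where
  "block_flag r p m k = (if k < r then block_binomial p m k else block_binomial (p - 1) (2 * m) (k - r))"

fun multiwavelet :: "nat \<Rightarrow> nat \<Rightarrow> nat \<times> nat \<times> nat \<Rightarrow> nat \<Rightarrow> real" where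
  "multiwavelet n r (p, m, k) = gram_schmidt n (block_flag r p m) k"

definition coarse_indices :: "nat \<Rightarrow> nat \<Rightarrow> nat \<Rightarrow> (nat \<times> nat \<times> nat) set" where
  "coarse_indices n r s = {s} \<times> {..n div 2 ^ s} \<times> {..<r}"

definition detail_indices :: "nat \<Rightarrow> nat \<Rightarrow> nat \<Rightarrow> (nat \<times> nat \<times> nat) set" where
  "detail_indices n r s = (SIGMA p:{1..s}. {..n div 2 ^ p} \<times> {r..<2 * r})"

lemma finite_coarse_indices: "finite (coarse_indices n r s)" and finite_detail_indices: "finite (detail_indices n r s)"
  by (auto simp: coarse_indices_def detail_indices_def)

lemma div_pow_parent: "i div 2 ^ Suc p = (i div 2 ^ p) div (2::nat)"
  by (simp only: power_Suc2 div_mult2_eq)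

lemma block_flag_support:
  assumes "k < r \<or> 1 \<le> p" "i div 2 ^ p \<noteq> m" "j \<le> k"
  shows "block_flag r p m j i = 0"
proof (cases "j < r")
  case True then show ?thesis using assms by (simp add: block_flag_def block_binomial_def)
next
  case False
  then obtain q where p: "p = Suc q" using assms by (cases p) auto
  have "i div 2 ^ q \<noteq> 2 * m" using assms(2) unfolding p div_pow_parent by auto
  then show ?thesis using False p by (simp add: block_flag_def block_binomial_def)
qed

lemma multiwavelet_support:
  assumes "k < r \<or> 1 \<le> p" "i div 2 ^ p \<noteq> m"
  shows "multiwavelet n r (p, m, k) i = 0"
  using block_flag_support[OF assms] by (auto intro: gram_schmidt_zero_at)

lemma detail_perp_block_binomial:
  assumes "r \<le> k" "a < r"
  shows "ip n (multiwavelet n r (p, m, k)) (block_binomial p m a) = 0"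
proof -
  have "ip n (gram_schmidt n (block_flag r p m) k) (block_flag r p m a) = 0"
    by (rule perp_gram_schmidt_imp_perp) (use assms in \<open>auto intro: gram_schmidt_ortho\<close>)
  then show ?thesis using assms by (simp add: block_flag_def)
qed

text \<open>
  A block of a coarser scale either contains the block \<open>m\<close> of scale \<open>p\<close> or is disjoint from it, and
  the restriction of a polynomial to a subset is given by the same polynomial.
\<close>
lemma perp_block_binomial_coarser:
  assumes supp: "\<And>i. i div 2 ^ p \<noteq> m \<Longrightarrow> x i = 0" and perp: "ip n x (block_binomial p m a) = 0" and "p \<le> P"
  shows "ip n x (block_binomial P M a) = 0"
proof -
  have anc: "i div 2 ^ P = (i div 2 ^ p) div 2 ^ (P - p)" for i :: nat
    using \<open>p \<le> P\<close> by (simp add: div_mult2_eq[symmetric] power_add[symmetric])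
  show ?thesis
  proof (cases "m div 2 ^ (P - p) = M")
    case True
    have "ip n x (block_binomial P M a) = ip n x (block_binomial p m a)"
      unfolding ip_def
    proof (intro sum.cong refl)
      fix i show "x i * block_binomial P M a i = x i * block_binomial p m a i"
        using supp[of i] True by (cases "i div 2 ^ p = m") (auto simp: block_binomial_def anc)
    qed
    then show ?thesis using perp by simp
  next
    case False
    have z: "x i * block_binomial P M a i = 0" for i
      using supp[of i] False by (cases "i div 2 ^ p = m") (auto simp: block_binomial_def anc)
    show ?thesis unfolding ip_def by (intro sum.neutral ballI z)
  qed
qed

text \<open>
  The finer function has vanishing moments on its block, and there the coarser one is a polynomial,
  since the finer block lies in one half of the coarser block or misses it.
\<close>
lemma multiwavelet_ortho_scales:
  assumes "1 \<le> p" "r \<le> k" "p < P" "K < 2 * r"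
  shows "ip n (multiwavelet n r (p, m, k)) (multiwavelet n r (P, M, K)) = 0"
proof -
  let ?x = "multiwavelet n r (p, m, k)"
  have coarser: "ip n ?x (block_binomial P' M' a) = 0" if "p \<le> P'" "a < r" for P' M' a
    by (rule perp_block_binomial_coarser[OF multiwavelet_support[OF disjI2[OF assms(1)]] detail_perp_block_binomial[OF assms(2) that(2)] that(1)])
  have "ip n ?x (gram_schmidt n (block_flag r P M) K) = 0"
  proof (rule perp_imp_perp_gram_schmidt)
    fix j assume "j \<le> K"
    then have "j < r \<or> j - r < r" "p \<le> P" "p \<le> P - 1" using assms by auto
    then show "ip n ?x (block_flag r P M j) = 0"
      unfolding block_flag_def by (cases "j < r") (simp_all del: multiwavelet.simps add: coarser)
  qed
  then show ?thesis by simp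
qed

lemma multiwavelet_ortho_system: "ortho_system n (coarse_indices n r s \<union> detail_indices n r s) (multiwavelet n r)"
proof -
  let ?W = "coarse_indices n r s \<union> detail_indices n r s"
  have "ip n (multiwavelet n r x) (multiwavelet n r y) = 0" if "x \<in> ?W" "y \<in> ?W" "x \<noteq> y" for x y
  proof -
    obtain p m k where x: "x = (p, m, k)" by (cases x) auto
    obtain P M K where y: "y = (P, M, K)" by (cases y) auto
    consider "p < P" | "P < p" | "p = P" "m = M" | "p = P" "m \<noteq> M" by linarith
    then show ?thesis
    proof cases
      case 1 then show ?thesis using that unfolding x y
        by (intro multiwavelet_ortho_scales) (auto simp: coarse_indices_def detail_indices_def)
    next
      case 2 then show ?thesis using that unfolding x y
        by (subst ip_commute, intro multiwavelet_ortho_scales) (auto simp: coarse_indices_def detail_indices_def)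
    next
      case 3 then show ?thesis using that unfolding x y by (auto intro: gram_schmidt_ortho)
    next
      case 4
      have xs: "k < r \<or> 1 \<le> p" "K < r \<or> 1 \<le> P" using that x y
        by (auto simp: coarse_indices_def detail_indices_def)
      have z: "multiwavelet n r (p, m, k) i * multiwavelet n r (P, M, K) i = 0" for i
        using multiwavelet_support[OF xs(1), of i m n] multiwavelet_support[OF xs(2), of i M n] 4
        by (cases "i div 2 ^ p = m") auto
      show ?thesis unfolding x y ip_def by (intro sum.neutral ballI z)
    qed
  qed
  moreover have "ip n (multiwavelet n r x) (multiwavelet n r x) \<in> {0, 1}" for x
    using gram_schmidt_norm by (cases x) auto
  ultimately show ?thesis
    unfolding ortho_system_def by (simp only: finite_Un finite_coarse_indices finite_detail_indices) simp
qed

lemma block_binomial_sibling: "block_binomial p (2 * M + 1) a i = block_binomial (Suc p) M a i - block_binomial p (2 * M) a i"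
proof -
  have "i div 2 ^ p = 2 * M + 1 \<longleftrightarrow> (i div 2 ^ p) div 2 = M \<and> i div 2 ^ p \<noteq> 2 * M"
    "i div 2 ^ p = 2 * M \<Longrightarrow> (i div 2 ^ p) div 2 = M" by auto
  then show ?thesis unfolding block_binomial_def div_pow_parent by (auto split: if_splits)
qed

text \<open>
  Orthogonality to all multiwavelets is passed down the scales: a vector orthogonal to the polynomials
  on a block and to the details of this block is orthogonal to the polynomials on both halves.  At
  scale 0 the blocks are single points.
\<close>
lemma multiwavelet_complete:
  assumes "1 \<le> r" and perp: "\<And>x. x \<in> coarse_indices n r s \<union> detail_indices n r s \<Longrightarrow> ip n u (multiwavelet n r x) = 0"
  shows "\<forall>i<n. u i = 0"
proof -
  have outside: "ip n u (block_binomial p m a) = 0" if "n div 2 ^ p < m" for p m a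
  proof -
    have "block_binomial p m a i = 0" if "i < n" for i
      using \<open>n div 2 ^ p < m\<close> div_le_mono[of i n "2 ^ p"] that by (auto simp: block_binomial_def)
    then show ?thesis by (simp add: ip_def)
  qed
  have "ip n u (block_binomial (s - j) m a) = 0" if "j \<le> s" "a < r" for j m a
    using that
  proof (induction j arbitrary: m a)
    case 0
    show ?case
    proof (cases "n div 2 ^ s < m")
      case False
      have "ip n u (block_flag r s m a) = 0"
      proof (rule perp_gram_schmidt_imp_perp)
        fix b assume "b \<le> a"
        then show "ip n u (gram_schmidt n (block_flag r s m) b) = 0"
          using perp[of "(s, m, b)"] False 0 by (auto simp: coarse_indices_def)
      qed
      then show ?thesis using 0 by (simp add: block_flag_def)
    qed (use outside in simp)
  next
    case (Suc j)
    define q where "q = s - Suc j"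
    have q: "s - j = Suc q" "Suc q \<le> s" using Suc.prems by (auto simp: q_def)
    have parent: "ip n u (block_binomial (Suc q) M b) = 0" if "b < r" for M b
      using Suc.IH[of b M] Suc.prems that q by simp
    have left: "ip n u (block_binomial q (2 * M) a) = 0" for M
    proof (cases "n div 2 ^ Suc q < M")
      case True
      then have "n div 2 ^ q < 2 * M" unfolding div_pow_parent by simp
      then show ?thesis by (rule outside)
    next
      case False
      have "ip n u (block_flag r (Suc q) M (r + a)) = 0"
      proof (rule perp_gram_schmidt_imp_perp)
        fix b assume b: "b \<le> r + a"
        show "ip n u (gram_schmidt n (block_flag r (Suc q) M) b) = 0"
        proof (cases "b < r")
          case True
          show ?thesis
            by (rule perp_imp_perp_gram_schmidt) (use True parent in \<open>auto simp: block_flag_def\<close>)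
        next
          case b': False
          have "(Suc q, M, b) \<in> detail_indices n r s"
            using b b' Suc.prems False q(2) by (auto simp: detail_indices_def)
          then show ?thesis using perp[of "(Suc q, M, b)"] by simp
        qed
      qed
      then show ?thesis by (simp add: block_flag_def)
    qed
    have "ip n u (block_binomial q m a) = 0"
    proof (cases "even m")
      case True then show ?thesis using left[of "m div 2"] by simp
    next
      case False
      then obtain M where m: "m = 2 * M + 1" by (rule oddE)
      have "block_binomial q m a = (\<lambda>i. block_binomial (Suc q) M a i - block_binomial q (2 * M) a i)"
        unfolding m by (intro ext block_binomial_sibling)
      then show ?thesis using parent[of a M] left Suc.prems by (simp add: ip_diff_right)
    qed
    then show ?case by (simp add: q_def)
  qed
  from this[of s 0] have "ip n u (block_binomial 0 i 0) = 0" for i using assms by simp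
  moreover have "ip n u (block_binomial 0 i 0) = u i" if "i < n" for i
  proof -
    have "ip n u (block_binomial 0 i 0) = (\<Sum>j<n. if j = i then u i else 0)"
      unfolding ip_def by (intro sum.cong) (auto simp: block_binomial_def)
    then show ?thesis using that by simp
  qed
  ultimately show ?thesis by simp
qed

section \<open>Decay of the detail coefficients\<close>

lemma Diff_Suc_inner: "Diff (Suc r) f = Diff r (\<lambda>i. f (Suc i) - f i)"
  by (induction r) auto

lemma increment_le_sum:
  fixes h :: "nat \<Rightarrow> real"
  assumes "\<And>j. a \<le> j \<Longrightarrow> j < i \<Longrightarrow> \<bar>h (Suc j) - h j\<bar> \<le> b j" "a \<le> i"
  shows "\<bar>h i - h a\<bar> \<le> (\<Sum>j=a..<i. b j)"
  using assms(2,1)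
proof (induction i rule: dec_induct)
  case (step i)
  have "\<bar>h (Suc i) - h i\<bar> \<le> b i" "\<bar>h i - h a\<bar> \<le> (\<Sum>j=a..<i. b j)" using step by auto
  then show ?case using step.hyps by simp
qed simp

text \<open>
  By summation: a polynomial approximating the first difference of \<open>f\<close> on the interval sums to a
  polynomial of one degree more that approximates \<open>f\<close>, once the constant is adjusted at the left end
  \<open>a\<close>.  Each summation costs a factor \<open>L\<close>.
\<close>
lemma polynomial_approximation:
  "1 \<le> r \<Longrightarrow> \<exists>c. \<forall>i. a \<le> i \<longrightarrow> i < a + L \<longrightarrow>
     \<bar>f i - (\<Sum>k<r. c k * real (i choose k))\<bar> \<le> real L ^ (r - 1) * (\<Sum>j=a..<a + L - r. \<bar>Diff r f j\<bar>)"
proof (induction r arbitrary: f L rule: dec_induct)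
  case base
  show ?case
  proof (intro exI[of _ "\<lambda>_. f a"] allI impI)
    fix i assume i: "a \<le> i" "i < a + L"
    have "\<bar>f i - f a\<bar> \<le> (\<Sum>j=a..<i. \<bar>Diff 1 f j\<bar>)"
      using i by (intro increment_le_sum) auto
    also have "\<dots> \<le> (\<Sum>j=a..<a + L - 1. \<bar>Diff 1 f j\<bar>)"
      using i by (intro sum_mono2) auto
    finally show "\<bar>f i - (\<Sum>k<1. f a * real (i choose k))\<bar>
        \<le> real L ^ (1 - 1) * (\<Sum>j=a..<a + L - 1. \<bar>Diff 1 f j\<bar>)" by simp
  qed
next
  case (step r)
  define g where "g = (\<lambda>i. f (Suc i) - f i)"
  define S where "S = (\<Sum>j=a..<a + L - Suc r. \<bar>Diff (Suc r) f j\<bar>)"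
  have S0: "0 \<le> S" by (simp add: S_def sum_nonneg)
  obtain c where c: "\<And>i. a \<le> i \<Longrightarrow> i < a + (L - 1) \<Longrightarrow>
     \<bar>g i - (\<Sum>k<r. c k * real (i choose k))\<bar> \<le> real (L - 1) ^ (r - 1) * (\<Sum>j=a..<a + (L - 1) - r. \<bar>Diff r g j\<bar>)"
    using step.IH[of "L - 1" g] by blast
  have Sg: "(\<Sum>j=a..<a + (L - 1) - r. \<bar>Diff r g j\<bar>) \<le> S"
    unfolding S_def Diff_Suc_inner g_def by (intro sum_mono2) auto
  have c': "\<bar>g i - (\<Sum>k<r. c k * real (i choose k))\<bar> \<le> real L ^ (r - 1) * S" if "a \<le> i" "i < a + (L - 1)" for i
  proof -
    have "real (L - 1) ^ (r - 1) * (\<Sum>j=a..<a + (L - 1) - r. \<bar>Diff r g j\<bar>) \<le> real L ^ (r - 1) * S"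
      using Sg by (intro mult_mono power_mono) (auto intro: sum_nonneg)
    then show ?thesis using c[OF that] by linarith
  qed
  define h where "h = (\<lambda>i. f i - (\<Sum>k<r. c k * real (i choose Suc k)))"
  \<comment> \<open>Summing a binomial coefficient raises its lower index by one; the new constant term is \<open>h a\<close>.\<close>
  define d where "d = case_nat (h a) c"
  have sum_d: "f i - (\<Sum>k<Suc r. d k * real (i choose k)) = h i - h a" for i
    unfolding sum.lessThan_Suc_shift d_def h_def by simp
  have dh: "h (Suc i) - h i = g i - (\<Sum>k<r. c k * real (i choose k))" for i
    by (simp add: h_def g_def algebra_simps sum.distrib)
  show ?case
  proof (intro exI[of _ d] allI impI)
    fix i assume i: "a \<le> i" "i < a + L"
    have "\<bar>h i - h a\<bar> \<le> (\<Sum>j=a..<i. real L ^ (r - 1) * S)"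
      unfolding dh[symmetric] using i c' by (intro increment_le_sum) (auto simp: dh)
    also have "\<dots> = real (i - a) * (real L ^ (r - 1) * S)" by simp
    also have "\<dots> \<le> real L * (real L ^ (r - 1) * S)"
      using i S0 by (intro mult_right_mono) auto
    also have "\<dots> = real L ^ (Suc r - 1) * S" using step.hyps by (cases r) auto
    finally show "\<bar>f i - (\<Sum>k<Suc r. d k * real (i choose k))\<bar>
        \<le> real L ^ (Suc r - 1) * (\<Sum>j=a..<a + L - Suc r. \<bar>Diff (Suc r) f j\<bar>)"
      by (simp only: sum_d S_def)
  qed
qed

text \<open>
  A detail function does not see the polynomial part of \<open>f\<close> on its block.  The remainder is controlled
  uniformly by the differences of order \<open>r\<close> inside the block, and the Cauchy-Schwarz inequality turns
  the uniform bound into one for the coefficient.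
\<close>
lemma detail_coeff_bound:
  assumes "1 \<le> r" "1 \<le> p" "r \<le> k"
  shows "\<bar>ip n f (multiwavelet n r (p, m, k))\<bar>
    \<le> sqrt (2 ^ p) * (2 ^ p) ^ (r - 1) * (\<Sum>j | j < n - r \<and> j div 2 ^ p = m. \<bar>Diff r f j\<bar>)"
proof -
  define x where "x = multiwavelet n r (p, m, k)"
  define S where "S = (\<Sum>j | j < n - r \<and> j div 2 ^ p = m. \<bar>Diff r f j\<bar>)"
  define I where "I = {i. i < n \<and> i div 2 ^ p = m}"
  define a where "a = m * 2 ^ p"
  define L where "L = min (2 ^ p) (n - a)"
  have blk: "i div 2 ^ p = m \<longleftrightarrow> a \<le> i \<and> i < a + 2 ^ p" for i :: nat
  proof -
    have "i div 2 ^ p = m \<longleftrightarrow> m \<le> i div 2 ^ p \<and> i div 2 ^ p < Suc m" by auto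
    also have "\<dots> \<longleftrightarrow> m * 2 ^ p \<le> i \<and> i < Suc m * 2 ^ p"
      by (simp only: less_eq_div_iff_mult_less_eq div_less_iff_less_mult zero_less_power zero_less_numeral)
    finally show ?thesis by (simp only: a_def mult_Suc add.commute)
  qed
  have "L \<le> 2 ^ p" by (simp add: L_def)
  then have "real L \<le> real (2 ^ p)" by (simp only: of_nat_le_iff)
  then have L: "real L \<le> 2 ^ p" by simp
  have I: "I \<subseteq> {a..<a + L}" by (auto simp: I_def blk L_def)
  have fin: "finite I" by (simp add: I_def)
  obtain c where c: "\<And>i. a \<le> i \<Longrightarrow> i < a + L \<Longrightarrow>
     \<bar>f i - (\<Sum>k<r. c k * real (i choose k))\<bar> \<le> real L ^ (r - 1) * (\<Sum>j=a..<a + L - r. \<bar>Diff r f j\<bar>)"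
    using polynomial_approximation[OF assms(1), of a L f] by blast
  have "(\<Sum>j=a..<a + L - r. \<bar>Diff r f j\<bar>) \<le> S"
    unfolding S_def by (intro sum_mono2) (auto simp: blk L_def)
  then have *: "real L ^ (r - 1) * (\<Sum>j=a..<a + L - r. \<bar>Diff r f j\<bar>) \<le> (2 ^ p) ^ (r - 1) * S"
    by (intro mult_mono power_mono L) (auto simp: S_def sum_nonneg)
  then have c': "\<bar>f i - (\<Sum>k<r. c k * real (i choose k))\<bar> \<le> (2 ^ p) ^ (r - 1) * S" if "i \<in> I" for i
  proof -
    have "a \<le> i" "i < a + L" using I that by auto
    then show ?thesis using c[of i] * by linarith
  qed
  have x0: "x i = 0" if "i < n" "i \<notin> I" for i
    using that assms unfolding x_def I_def by (intro multiwavelet_support) auto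
  have perp: "(\<Sum>i\<in>I. real (i choose b) * x i) = 0" if "b < r" for b
  proof -
    have "ip n x (block_binomial p m b) = (\<Sum>i\<in>I. real (i choose b) * x i)"
      unfolding ip_def by (rule sum.mono_neutral_cong_right) (auto simp: I_def block_binomial_def)
    then show ?thesis using detail_perp_block_binomial[OF assms(3) that] by (simp add: x_def)
  qed
  have "ip n f x = (\<Sum>i\<in>I. f i * x i)"
    unfolding ip_def
  proof (rule sum.mono_neutral_right)
    show "\<forall>i\<in>{..<n} - I. f i * x i = 0" by (simp add: x0)
  qed (auto simp: I_def)
  also have "\<dots> = (\<Sum>i\<in>I. (f i - (\<Sum>k<r. c k * real (i choose k))) * x i)
       + (\<Sum>i\<in>I. \<Sum>k<r. c k * (real (i choose k) * x i))"
    unfolding sum.distrib[symmetric]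
  proof (intro sum.cong refl)
    fix i
    have "(\<Sum>k<r. c k * (real (i choose k) * x i)) = (\<Sum>k<r. c k * real (i choose k)) * x i"
      by (simp only: sum_distrib_right mult.assoc)
    then show "f i * x i = (f i - (\<Sum>k<r. c k * real (i choose k))) * x i + (\<Sum>k<r. c k * (real (i choose k) * x i))"
      by (simp only: left_diff_distrib diff_add_cancel)
  qed
  also have "(\<Sum>i\<in>I. \<Sum>k<r. c k * (real (i choose k) * x i)) = 0"
    by (subst sum.swap, subst sum_distrib_left[symmetric]) (simp add: perp)
  finally have "\<bar>ip n f x\<bar> \<le> (\<Sum>i\<in>I. \<bar>(f i - (\<Sum>k<r. c k * real (i choose k))) * x i\<bar>)"
    by (simp only: add_0_right sum_abs)
  also have "\<dots> \<le> (\<Sum>i\<in>I. (2 ^ p) ^ (r - 1) * S * \<bar>x i\<bar>)"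
    unfolding abs_mult using c' by (intro sum_mono mult_right_mono) auto
  also have "\<dots> = (2 ^ p) ^ (r - 1) * S * (\<Sum>i\<in>I. \<bar>1\<bar> * \<bar>x i\<bar>)" by (simp add: sum_distrib_left)
  also have "\<dots> \<le> (2 ^ p) ^ (r - 1) * S * (L2_set (\<lambda>_. 1) I * L2_set x I)"
    by (intro mult_left_mono L2_set_mult_ineq) (auto simp: S_def sum_nonneg)
  also have "\<dots> \<le> (2 ^ p) ^ (r - 1) * S * (sqrt (2 ^ p) * 1)"
  proof (intro mult_left_mono mult_mono)
    have "card I \<le> L" using card_mono[OF _ I] by simp
    then have "real (card I) \<le> 2 ^ p" using L by linarith
    then show "L2_set (\<lambda>_. 1) I \<le> sqrt (2 ^ p)" by (simp add: L2_set_def)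
    have "(\<Sum>i\<in>I. (x i)\<^sup>2) \<le> ip n x x"
      unfolding ip_def power2_eq_square by (intro sum_mono2) (auto simp: I_def)
    also have "\<dots> \<le> 1" using gram_schmidt_norm[of n "block_flag r p m" k] by (auto simp: x_def)
    finally show "L2_set x I \<le> 1" by (simp add: L2_set_def)
  qed (auto simp: S_def sum_nonneg)
  finally show ?thesis by (simp add: x_def S_def algebra_simps)
qed

section \<open>Exponential moments of Gaussian coefficients\<close>

lemma nn_integral_normal_density:
  assumes "0 < \<sigma>"
  shows "(\<integral>\<^sup>+ y. ennreal (normal_density \<mu> \<sigma> y) \<partial>lborel) = 1"
  using assms by (subst nn_integral_eq_integral) auto

text \<open>
  Completing the square turns the tilted density into the density of a shifted normal law.
\<close>
lemma normal_exp_linear: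
  assumes "0 < \<sigma>"
  shows "(\<integral>\<^sup>+ y. ennreal (exp (a * (y - \<mu>))) \<partial>density lborel (normal_density \<mu> \<sigma>))
    = ennreal (exp (\<sigma>\<^sup>2 * a\<^sup>2 / 2))"
proof -
  have eq: "normal_density \<mu> \<sigma> y * exp (a * (y - \<mu>))
      = exp (\<sigma>\<^sup>2 * a\<^sup>2 / 2) * normal_density (\<mu> + a * \<sigma>\<^sup>2) \<sigma> y" for y
  proof -
    have "- (y - \<mu>)\<^sup>2 / (2 * \<sigma>\<^sup>2) + a * (y - \<mu>) = \<sigma>\<^sup>2 * a\<^sup>2 / 2 + - (y - (\<mu> + a * \<sigma>\<^sup>2))\<^sup>2 / (2 * \<sigma>\<^sup>2)"
      using assms by (simp add: field_simps power2_eq_square)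
    then have "exp (- (y - \<mu>)\<^sup>2 / (2 * \<sigma>\<^sup>2)) * exp (a * (y - \<mu>))
        = exp (\<sigma>\<^sup>2 * a\<^sup>2 / 2) * exp (- (y - (\<mu> + a * \<sigma>\<^sup>2))\<^sup>2 / (2 * \<sigma>\<^sup>2))"
      by (simp only: exp_add[symmetric])
    then show ?thesis unfolding normal_density_def by (simp add: mult_ac)
  qed
  have "(\<integral>\<^sup>+ y. ennreal (exp (a * (y - \<mu>))) \<partial>density lborel (normal_density \<mu> \<sigma>))
      = (\<integral>\<^sup>+ y. ennreal (exp (\<sigma>\<^sup>2 * a\<^sup>2 / 2)) * ennreal (normal_density (\<mu> + a * \<sigma>\<^sup>2) \<sigma> y) \<partial>lborel)"
    by (subst nn_integral_density) (auto simp: ennreal_mult[symmetric] eq)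
  also have "\<dots> = ennreal (exp (\<sigma>\<^sup>2 * a\<^sup>2 / 2))"
    by (subst nn_integral_cmult) (auto simp: nn_integral_normal_density[OF assms])
  finally show ?thesis .
qed

lemma std_normal_exp_square:
  "(\<integral>\<^sup>+ g. ennreal (exp (g\<^sup>2 / 4)) \<partial>density lborel std_normal_density) = ennreal (sqrt 2)"
proof -
  have eq: "std_normal_density g * exp (g\<^sup>2 / 4) = sqrt 2 * normal_density 0 (sqrt 2) g" for g
  proof -
    have "exp (- g\<^sup>2 / 2) * exp (g\<^sup>2 / 4) = exp (- g\<^sup>2 / 4)"
      by (simp add: exp_add[symmetric])
    then show ?thesis
      by (simp add: normal_density_def real_sqrt_mult field_simps)
  qed
  have "(\<integral>\<^sup>+ g. ennreal (exp (g\<^sup>2 / 4)) \<partial>density lborel std_normal_density)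
      = (\<integral>\<^sup>+ g. ennreal (sqrt 2) * ennreal (normal_density 0 (sqrt 2) g) \<partial>lborel)"
    by (subst nn_integral_density) (auto simp: ennreal_mult[symmetric] eq)
  also have "\<dots> = ennreal (sqrt 2)"
    by (subst nn_integral_cmult) (auto simp: nn_integral_normal_density)
  finally show ?thesis .
qed

lemma product_prob_space_normal:
  "(\<And>i. 0 < \<sigma> i) \<Longrightarrow> product_prob_space (\<lambda>i. density lborel (normal_density (\<mu> i) (\<sigma> i)))"
  by (intro product_prob_spaceI prob_space_normal_density)

lemma prob_space_gaussian_vec: "0 < \<sigma> \<Longrightarrow> prob_space (gaussian_vec n \<theta> \<sigma>)"
  unfolding gaussian_vec_def by (intro prob_space_PiM prob_space_normal_density)

lemma sets_gaussian_vec [measurable_cong]: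
  "sets (gaussian_vec n \<theta> \<sigma>) = sets (\<Pi>\<^sub>M i\<in>{..<n}. (borel :: real measure))"
  unfolding gaussian_vec_def by (intro sets_PiM_cong) auto

definition noise :: "(nat \<Rightarrow> real) \<Rightarrow> (nat \<Rightarrow> real) \<Rightarrow> nat \<Rightarrow> real" where
  "noise \<theta> Y i = Y i - \<theta> i"

lemma ip_noise_measurable [measurable]:
  "(\<lambda>Y. ip n (noise \<theta> Y) u) \<in> borel_measurable (\<Pi>\<^sub>M i\<in>{..<n}. borel)"
  unfolding ip_def noise_def by measurable

lemma nn_integral_PiM_exp_sum:
  assumes "finite I" "\<And>i. i \<in> I \<Longrightarrow> 0 < \<sigma> i"
    and "\<And>i. i \<in> I \<Longrightarrow> f i \<in> borel_measurable borel"
  shows "(\<integral>\<^sup>+ x. ennreal (exp (\<Sum>i\<in>I. f i (x i))) \<partial>(\<Pi>\<^sub>M i\<in>I. density lborel (normal_density (\<mu> i) (\<sigma> i))))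
    = (\<Prod>i\<in>I. \<integral>\<^sup>+ y. ennreal (exp (f i y)) \<partial>density lborel (normal_density (\<mu> i) (\<sigma> i)))"
proof -
  define s where "s = (\<lambda>i. if i \<in> I then \<sigma> i else 1)"
  interpret product_prob_space "\<lambda>i. density lborel (normal_density (\<mu> i) (s i))"
    by (rule product_prob_space_normal) (use assms in \<open>simp add: s_def\<close>)
  have "(\<Pi>\<^sub>M i\<in>I. density lborel (normal_density (\<mu> i) (\<sigma> i))) = (\<Pi>\<^sub>M i\<in>I. density lborel (normal_density (\<mu> i) (s i)))"
    by (intro PiM_cong) (auto simp: s_def)
  then show ?thesis
    using product_nn_integral_prod[OF assms(1), of "\<lambda>i y. ennreal (exp (f i y))"] assms
    by (simp add: exp_sum prod_ennreal s_def)
qed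

lemma gaussian_vec_exp_linear:
  assumes "0 < \<sigma>"
  shows "(\<integral>\<^sup>+ Y. ennreal (exp (ip n (noise \<theta> Y) a)) \<partial>gaussian_vec n \<theta> \<sigma>)
    = ennreal (exp (\<sigma>\<^sup>2 * ip n a a / 2))"
proof -
  have "(\<integral>\<^sup>+ Y. ennreal (exp (ip n (noise \<theta> Y) a)) \<partial>gaussian_vec n \<theta> \<sigma>)
      = (\<integral>\<^sup>+ Y. ennreal (exp (\<Sum>i<n. a i * (Y i - \<theta> i))) \<partial>gaussian_vec n \<theta> \<sigma>)"
    by (simp add: ip_def noise_def mult.commute)
  also have "\<dots> = (\<Prod>i<n. ennreal (exp (\<sigma>\<^sup>2 * (a i)\<^sup>2 / 2)))"
    unfolding gaussian_vec_def using assms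
    by (subst nn_integral_PiM_exp_sum) (auto simp: normal_exp_linear)
  also have "\<dots> = ennreal (exp (\<Sum>i<n. \<sigma>\<^sup>2 * (a i)\<^sup>2 / 2))"
    by (simp add: prod_ennreal exp_sum)
  also have "(\<Sum>i<n. \<sigma>\<^sup>2 * (a i)\<^sup>2 / 2) = \<sigma>\<^sup>2 * ip n a a / 2"
    by (simp add: ip_def sum_distrib_left sum_divide_distrib power2_eq_square)
  finally show ?thesis .
qed

text \<open>
  The coefficients of the noise in an orthonormal system are independent and normal or zero.  For the
  exponential moment this can be seen by linearising each square through
  \<open>exp (z\<^sup>2 / 4) = E (exp (g * z / sqrt 2))\<close> with an auxiliary standard normal \<open>g\<close>.  After exchanging
  the integrals, the noise is integrated against one linear form, and orthogonality enters only
  through the norm of its coefficient vector.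
\<close>
lemma gaussian_vec_exp_squares:
  assumes \<sigma>: "0 < \<sigma>" and W: "ortho_system n W w"
  shows "(\<integral>\<^sup>+ Y. ennreal (exp (\<Sum>k\<in>W. (ip n (noise \<theta> Y) (w k))\<^sup>2 / (4 * \<sigma>\<^sup>2))) \<partial>gaussian_vec n \<theta> \<sigma>)
    \<le> ennreal (sqrt 2 ^ card W)"
proof -
  have fin: "finite W" using W by (simp add: ortho_system_def)
  define c where "c = 1 / (sqrt 2 * \<sigma>)"
  define G where "G = (\<Pi>\<^sub>M k\<in>W. density lborel (normal_density 0 1))"
  have setsG [measurable_cong]: "sets G = sets (\<Pi>\<^sub>M k\<in>W. (borel :: real measure))"
    unfolding G_def by (intro sets_PiM_cong) auto
  interpret N: prob_space "gaussian_vec n \<theta> \<sigma>" by (rule prob_space_gaussian_vec[OF \<sigma>])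
  interpret G: prob_space G unfolding G_def by (intro prob_space_PiM prob_space_normal_density) simp
  interpret GN: pair_sigma_finite G "gaussian_vec n \<theta> \<sigma>" ..
  have lin: "(\<integral>\<^sup>+ g. ennreal (exp (\<Sum>k\<in>W. (c * z k) * g k)) \<partial>G) = ennreal (exp (\<Sum>k\<in>W. (z k)\<^sup>2 / (4 * \<sigma>\<^sup>2)))" for z
  proof -
    have "(\<integral>\<^sup>+ g. ennreal (exp (\<Sum>k\<in>W. (c * z k) * g k)) \<partial>G) = (\<Prod>k\<in>W. ennreal (exp ((c * z k)\<^sup>2 / 2)))"
      unfolding G_def
      by (subst nn_integral_PiM_exp_sum[OF fin]) (auto simp: normal_exp_linear[where \<mu> = 0 and \<sigma> = 1, simplified])
    also have "\<dots> = ennreal (exp (\<Sum>k\<in>W. (z k)\<^sup>2 / (4 * \<sigma>\<^sup>2)))"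
      by (simp add: prod_ennreal exp_sum[OF fin] c_def power_mult_distrib power_divide field_simps)
    finally show ?thesis .
  qed
  have "(\<integral>\<^sup>+ Y. ennreal (exp (\<Sum>k\<in>W. (ip n (noise \<theta> Y) (w k))\<^sup>2 / (4 * \<sigma>\<^sup>2))) \<partial>gaussian_vec n \<theta> \<sigma>)
      = (\<integral>\<^sup>+ Y. \<integral>\<^sup>+ g. ennreal (exp (\<Sum>k\<in>W. (c * ip n (noise \<theta> Y) (w k)) * g k)) \<partial>G \<partial>gaussian_vec n \<theta> \<sigma>)"
    by (simp add: lin)
  also have "\<dots> = (\<integral>\<^sup>+ g. \<integral>\<^sup>+ Y. ennreal (exp (\<Sum>k\<in>W. (c * ip n (noise \<theta> Y) (w k)) * g k)) \<partial>gaussian_vec n \<theta> \<sigma> \<partial>G)"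
    by (rule GN.Fubini') measurable
  also have "\<dots> = (\<integral>\<^sup>+ g. \<integral>\<^sup>+ Y. ennreal (exp (ip n (noise \<theta> Y) (\<lambda>i. \<Sum>k\<in>W. (c * g k) * w k i))) \<partial>gaussian_vec n \<theta> \<sigma> \<partial>G)"
    by (simp only: ip_sum_right) (simp add: mult_ac)
  also have "\<dots> \<le> (\<integral>\<^sup>+ g. ennreal (exp (\<Sum>k\<in>W. (g k)\<^sup>2 / 4)) \<partial>G)"
  proof (intro nn_integral_mono)
    fix g
    have "\<sigma>\<^sup>2 * ip n (\<lambda>i. \<Sum>k\<in>W. (c * g k) * w k i) (\<lambda>i. \<Sum>k\<in>W. (c * g k) * w k i) / 2
        \<le> \<sigma>\<^sup>2 * (\<Sum>k\<in>W. (c * g k)\<^sup>2) / 2"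
      by (intro divide_right_mono mult_left_mono ortho_system_norm_sum W) auto
    also have "\<dots> = (\<Sum>k\<in>W. (g k)\<^sup>2 / 4)"
      using \<sigma> by (simp add: c_def power_mult_distrib power_divide sum_distrib_left sum_divide_distrib)
    finally show "(\<integral>\<^sup>+ Y. ennreal (exp (ip n (noise \<theta> Y) (\<lambda>i. \<Sum>k\<in>W. (c * g k) * w k i))) \<partial>gaussian_vec n \<theta> \<sigma>)
        \<le> ennreal (exp (\<Sum>k\<in>W. (g k)\<^sup>2 / 4))"
      unfolding gaussian_vec_exp_linear[OF \<sigma>] by (intro ennreal_leI) simp
  qed
  also have "\<dots> = (\<Prod>k\<in>W. ennreal (sqrt 2))"
    unfolding G_def by (subst nn_integral_PiM_exp_sum[OF fin]) (auto simp: std_normal_exp_square)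
  also have "\<dots> = ennreal (sqrt 2 ^ card W)" by (simp add: ennreal_power)
  finally show ?thesis .
qed

text \<open>
  Beyond the threshold \<open>(\<bar>z\<bar> - \<tau>)\<^sup>2 \<le> z\<^sup>2 - \<tau>\<^sup>2\<close>.  Thus a soft-thresholded square costs only the small
  factor \<open>exp (- l * \<tau>\<^sup>2)\<close> in front of the exponential moment of the full square.
\<close>
lemma exp_soft_threshold_le:
  fixes z \<tau> l :: real
  assumes "0 \<le> \<tau>" "0 \<le> l"
  shows "exp (l * (max 0 (\<bar>z\<bar> - \<tau>))\<^sup>2) \<le> 1 + exp (- l * \<tau>\<^sup>2) * exp (l * z\<^sup>2)"
proof (cases "\<bar>z\<bar> \<le> \<tau>")
  case False
  have "(\<bar>z\<bar> - \<tau>)\<^sup>2 \<le> z\<^sup>2 - \<tau>\<^sup>2"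
  proof -
    have "(z\<^sup>2 - \<tau>\<^sup>2) - (\<bar>z\<bar> - \<tau>)\<^sup>2 = 2 * \<tau> * (\<bar>z\<bar> - \<tau>)"
      by (simp add: power2_eq_square algebra_simps)
    moreover have "0 \<le> 2 * \<tau> * (\<bar>z\<bar> - \<tau>)" using False assms by auto
    ultimately show ?thesis by linarith
  qed
  then have "l * (max 0 (\<bar>z\<bar> - \<tau>))\<^sup>2 \<le> - l * \<tau>\<^sup>2 + l * z\<^sup>2"
    using False assms mult_left_mono[of "(\<bar>z\<bar> - \<tau>)\<^sup>2" "z\<^sup>2 - \<tau>\<^sup>2" l] by (simp add: algebra_simps max_def)
  then have "exp (l * (max 0 (\<bar>z\<bar> - \<tau>))\<^sup>2) \<le> exp (- l * \<tau>\<^sup>2) * exp (l * z\<^sup>2)"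
    by (simp only: exp_add[symmetric] exp_le_cancel_iff)
  then show ?thesis by simp
qed simp

text \<open>
  The product over the coefficients of the bound \<open>1 + q k * e k\<close> is expanded into a sum over subsets,
  since exponential moments are available for the sum of squares over each subset.
\<close>
lemma gaussian_vec_exp_threshold:
  assumes \<sigma>: "0 < \<sigma>" and W: "ortho_system n W w" and \<tau>: "\<And>k. k \<in> W \<Longrightarrow> 0 \<le> \<tau> k"
  shows "(\<integral>\<^sup>+ Y. ennreal (exp ((\<Sum>k\<in>W. (max 0 (\<bar>ip n (noise \<theta> Y) (w k)\<bar> - \<tau> k))\<^sup>2) / (4 * \<sigma>\<^sup>2))) \<partial>gaussian_vec n \<theta> \<sigma>)
    \<le> ennreal (exp (\<Sum>k\<in>W. 2 * exp (- (\<tau> k)\<^sup>2 / (4 * \<sigma>\<^sup>2))))"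
proof -
  define N where "N = gaussian_vec n \<theta> \<sigma>"
  have [measurable_cong]: "sets N = sets (\<Pi>\<^sub>M i\<in>{..<n}. (borel :: real measure))"
    unfolding N_def by (rule sets_gaussian_vec)
  have fin: "finite W" using W by (simp add: ortho_system_def)
  define z where "z = (\<lambda>k Y. ip n (noise \<theta> Y) (w k))"
  have [measurable]: "z k \<in> borel_measurable N" for k unfolding z_def by measurable
  define q where "q = (\<lambda>k. exp (- (\<tau> k)\<^sup>2 / (4 * \<sigma>\<^sup>2)))"
  define e where "e = (\<lambda>k Y. exp ((z k Y)\<^sup>2 / (4 * \<sigma>\<^sup>2)))"
  have q0: "0 \<le> q k" and e0: "0 \<le> e k Y" for k Y by (auto simp: q_def e_def)
  have [measurable]: "e k \<in> borel_measurable N" for k unfolding e_def by measurable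
  have point: "exp ((\<Sum>k\<in>W. (max 0 (\<bar>z k Y\<bar> - \<tau> k))\<^sup>2) / (4 * \<sigma>\<^sup>2))
      \<le> (\<Sum>X\<in>Pow W. (\<Prod>k\<in>X. q k) * (\<Prod>k\<in>X. e k Y))" for Y
  proof -
    have "exp ((\<Sum>k\<in>W. (max 0 (\<bar>z k Y\<bar> - \<tau> k))\<^sup>2) / (4 * \<sigma>\<^sup>2))
        = (\<Prod>k\<in>W. exp (1 / (4 * \<sigma>\<^sup>2) * (max 0 (\<bar>z k Y\<bar> - \<tau> k))\<^sup>2))"
      by (simp add: sum_divide_distrib exp_sum[OF fin])
    also have "\<dots> \<le> (\<Prod>k\<in>W. q k * e k Y + 1)"
      using exp_soft_threshold_le[OF \<tau>, of _ "1 / (4 * \<sigma>\<^sup>2)"]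
      by (intro prod_mono) (auto simp: q_def e_def add.commute)
    also have "\<dots> = (\<Sum>X\<in>Pow W. (\<Prod>k\<in>X. q k) * (\<Prod>k\<in>X. e k Y))"
      by (subst prod_add[OF fin]) (simp add: prod.distrib)
    finally show ?thesis .
  qed
  have "(\<integral>\<^sup>+ Y. ennreal (exp ((\<Sum>k\<in>W. (max 0 (\<bar>z k Y\<bar> - \<tau> k))\<^sup>2) / (4 * \<sigma>\<^sup>2))) \<partial>N)
      \<le> (\<integral>\<^sup>+ Y. (\<Sum>X\<in>Pow W. ennreal (\<Prod>k\<in>X. q k) * ennreal (\<Prod>k\<in>X. e k Y)) \<partial>N)"
  proof (intro nn_integral_mono)
    fix Y
    have "(\<Sum>X\<in>Pow W. ennreal (\<Prod>k\<in>X. q k) * ennreal (\<Prod>k\<in>X. e k Y))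
        = ennreal (\<Sum>X\<in>Pow W. (\<Prod>k\<in>X. q k) * (\<Prod>k\<in>X. e k Y))"
      by (subst sum_ennreal[symmetric]) (auto simp: ennreal_mult prod_nonneg q0 e0)
    then show "ennreal (exp ((\<Sum>k\<in>W. (max 0 (\<bar>z k Y\<bar> - \<tau> k))\<^sup>2) / (4 * \<sigma>\<^sup>2)))
        \<le> (\<Sum>X\<in>Pow W. ennreal (\<Prod>k\<in>X. q k) * ennreal (\<Prod>k\<in>X. e k Y))"
      using point[of Y] by (simp add: ennreal_leI)
  qed
  also have "\<dots> = (\<Sum>X\<in>Pow W. ennreal (\<Prod>k\<in>X. q k) * (\<integral>\<^sup>+ Y. ennreal (\<Prod>k\<in>X. e k Y) \<partial>N))"
    by (subst nn_integral_sum) (auto intro!: sum.cong nn_integral_cmult)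
  also have "\<dots> \<le> (\<Sum>X\<in>Pow W. ennreal (\<Prod>k\<in>X. q k) * ennreal (2 ^ card X))"
  proof (intro sum_mono mult_left_mono)
    fix X assume X: "X \<in> Pow W"
    then have finX: "finite X" using fin finite_subset by auto
    have oX: "ortho_system n X w" using W X finX by (auto simp: ortho_system_def)
    have "(\<integral>\<^sup>+ Y. ennreal (\<Prod>k\<in>X. e k Y) \<partial>N) \<le> ennreal (sqrt 2 ^ card X)"
      using gaussian_vec_exp_squares[OF \<sigma> oX, of \<theta>] by (simp add: e_def z_def N_def exp_sum[OF finX])
    also have "\<dots> \<le> ennreal (2 ^ card X)"
      by (intro ennreal_leI power_mono) (auto intro: real_le_lsqrt)
    finally show "(\<integral>\<^sup>+ Y. ennreal (\<Prod>k\<in>X. e k Y) \<partial>N) \<le> ennreal (2 ^ card X)" .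
  qed auto
  also have "\<dots> = ennreal (\<Sum>X\<in>Pow W. (\<Prod>k\<in>X. q k) * (\<Prod>k\<in>X. 2))"
    by (subst sum_ennreal[symmetric]) (auto simp: ennreal_mult prod_nonneg q0)
  also have "(\<Sum>X\<in>Pow W. (\<Prod>k\<in>X. q k) * (\<Prod>k\<in>X. 2)) = (\<Prod>k\<in>W. q k * 2 + 1)"
    by (subst prod_add[OF fin]) (simp add: prod.distrib)
  also have "ennreal \<dots> \<le> ennreal (\<Prod>k\<in>W. exp (2 * q k))"
  proof (intro ennreal_leI prod_mono conjI)
    fix k
    show "q k * 2 + 1 \<le> exp (2 * q k)" using exp_ge_add_one_self[of "2 * q k"] by linarith
  qed (simp add: q0)
  also have "\<dots> = ennreal (exp (\<Sum>k\<in>W. 2 * q k))" by (simp add: exp_sum[OF fin])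
  finally show ?thesis by (simp add: N_def z_def q_def)
qed

section \<open>The estimator as a projection\<close>

lemma sq_dist_eq_ip: "sq_dist n u v = ip n (\<lambda>i. u i - v i) (\<lambda>i. u i - v i)"
  by (simp add: sq_dist_def L2_set_def ip_def power2_eq_square sum_nonneg)

lemma Diff_cong: "(\<And>j. j \<le> r \<Longrightarrow> u (i + j) = v (i + j)) \<Longrightarrow> Diff r u i = Diff r v i"
proof (induction r arbitrary: i)
  case (Suc r)
  have "Diff r u (Suc i) = Diff r v (Suc i)"
    using Suc.prems[of "Suc _"] by (intro Suc.IH) auto
  moreover have "Diff r u i = Diff r v i" by (intro Suc.IH Suc.prems) auto
  ultimately show ?case by simp
next
  case 0
  from 0[of 0] show ?case by simp
qed

lemma Diff_norm1_cong: "(\<And>i. i < n \<Longrightarrow> u i = v i) \<Longrightarrow> Diff_norm1 n r u = Diff_norm1 n r v"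
  unfolding Diff_norm1_def by (intro sum.cong arg_cong[where f = abs] Diff_cong) auto

lemma Diff_linear: "Diff r (\<lambda>i. a * u i + b * v i) i = a * Diff r u i + b * Diff r v i"
  by (induction r arbitrary: i) (auto simp: algebra_simps)

lemma Diff_norm1_linear:
  "Diff_norm1 n r (\<lambda>i. a * u i + b * v i) \<le> \<bar>a\<bar> * Diff_norm1 n r u + \<bar>b\<bar> * Diff_norm1 n r v"
  unfolding Diff_norm1_def Diff_linear sum_distrib_left sum.distrib[symmetric]
  by (intro sum_mono) (metis abs_mult abs_triangle_ineq)

lemma Diff_norm1_diff: "Diff_norm1 n r (\<lambda>i. u i - v i) \<le> Diff_norm1 n r u + Diff_norm1 n r v"
  using Diff_norm1_linear[of n r 1 u "-1" v] by simp

definition feasible :: "nat \<Rightarrow> nat \<Rightarrow> real \<Rightarrow> (nat \<Rightarrow> real) set" where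
  "feasible n r b = {\<theta> \<in> Rn n. Diff_norm1 n r \<theta> \<le> b}"

lemma feasible_convex:
  assumes "u \<in> feasible n r b" "v \<in> feasible n r b" "0 \<le> t" "t \<le> 1"
  shows "restrict (\<lambda>i. (1 - t) * u i + t * v i) {..<n} \<in> feasible n r b"
proof -
  have "Diff_norm1 n r (restrict (\<lambda>i. (1 - t) * u i + t * v i) {..<n})
      = Diff_norm1 n r (\<lambda>i. (1 - t) * u i + t * v i)"
    by (rule Diff_norm1_cong) simp
  also have "\<dots> \<le> \<bar>1 - t\<bar> * Diff_norm1 n r u + \<bar>t\<bar> * Diff_norm1 n r v"
    by (rule Diff_norm1_linear)
  also have "\<dots> \<le> (1 - t) * b + t * b"
    using assms by (intro add_mono mult_mono) (auto simp: feasible_def Diff_norm1_def sum_nonneg)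
  also have "\<dots> = b" by (simp add: algebra_simps)
  finally show ?thesis by (simp add: feasible_def)
qed

lemma continuous_on_coordinate: "continuous_on S (\<lambda>\<theta> :: nat \<Rightarrow> real. \<theta> i)"
  by (rule continuous_on_subset[OF continuous_on_product_coordinates]) simp

lemma continuous_on_Diff: "continuous_on S (\<lambda>\<theta>. Diff r \<theta> i)"
proof (induction r arbitrary: i)
  case 0
  show ?case using continuous_on_coordinate by simp
next
  case (Suc r)
  show ?case unfolding Diff.simps by (intro continuous_on_diff Suc.IH)
qed

text \<open>
  Competitors that do at least as well as a given feasible \<open>w\<close> lie in a product of compact intervals.
\<close>
lemma feasible_minimiser_exists:
  assumes "feasible n r b \<noteq> {}"
  shows "\<exists>u\<in>feasible n r b. \<forall>v\<in>feasible n r b. sq_dist n Y u \<le> sq_dist n Y v"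
proof -
  obtain w where w: "w \<in> feasible n r b" using assms by auto
  define R where "R = sqrt (sq_dist n Y w)"
  \<comment> \<open>Outside the index range the vectors take the default value, which the singleton records.\<close>
  define B where "B = (\<lambda>i. if i < n then {Y i - R..Y i + R} else {undefined})"
  define K where "K = (\<Pi>\<^sub>E i\<in>UNIV. B i) \<inter> {\<theta>. Diff_norm1 n r \<theta> \<le> b}"
  have "compact (\<Pi>\<^sub>E i\<in>UNIV. B i)"
    using compactin_PiE[of "\<lambda>_. euclidean" UNIV B]
    by (simp add: euclidean_product_topology B_def)
  moreover have "closed {\<theta>. Diff_norm1 n r \<theta> \<le> b}"
    unfolding Diff_norm1_def by (intro closed_Collect_le continuous_intros continuous_on_Diff)
  ultimately have K: "compact K" unfolding K_def by (rule compact_Int_closed)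
  have sub: "K \<subseteq> feasible n r b"
    by (auto simp: K_def feasible_def B_def PiE_iff extensional_def) (metis singletonD lessThan_iff)
  have inK: "v \<in> K" if "v \<in> feasible n r b" "sq_dist n Y v \<le> sq_dist n Y w" for v
  proof -
    have "\<bar>Y i - v i\<bar> \<le> R" if "i < n" for i
    proof -
      have "(Y i - v i)\<^sup>2 \<le> ip n (\<lambda>i. Y i - v i) (\<lambda>i. Y i - v i)"
        unfolding ip_def power2_eq_square[symmetric]
        by (rule member_le_sum) (use that in auto)
      then have "(Y i - v i)\<^sup>2 \<le> sq_dist n Y w"
        using \<open>sq_dist n Y v \<le> sq_dist n Y w\<close> by (simp add: sq_dist_eq_ip)
      then show ?thesis unfolding R_def by (rule real_le_rsqrt[of "\<bar>_\<bar>", simplified])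
    qed
    then have "v i \<in> B i" for i
      using that(1) by (cases "i < n") (force simp: B_def feasible_def PiE_iff extensional_def abs_le_iff)+
    then show ?thesis using that(1) by (simp add: K_def feasible_def PiE_iff)
  qed
  have "continuous_on K (\<lambda>\<theta>. sq_dist n Y \<theta>)"
    unfolding sq_dist_eq_ip ip_def
    by (intro continuous_intros continuous_on_coordinate)
  then obtain u where u: "u \<in> K" "\<And>v. v \<in> K \<Longrightarrow> sq_dist n Y u \<le> sq_dist n Y v"
    using continuous_attains_inf[OF K] inK[OF w] by blast
  show ?thesis
  proof (intro bexI ballI)
    fix v assume v: "v \<in> feasible n r b"
    show "sq_dist n Y u \<le> sq_dist n Y v"
    proof (cases "sq_dist n Y v \<le> sq_dist n Y w")
      case True then show ?thesis using u inK v by blast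
    next
      case False then show ?thesis using u(2)[OF inK[OF w]] by simp
    qed
  qed (use u sub in auto)
qed

lemma trend_filter_minimises:
  assumes "feasible n r (V * real n powi (1 - int r)) \<noteq> {}"
  shows "trend_filter n r V Y \<in> feasible n r (V * real n powi (1 - int r))"
    and "v \<in> feasible n r (V * real n powi (1 - int r)) \<Longrightarrow> sq_dist n Y (trend_filter n r V Y) \<le> sq_dist n Y v"
proof -
  let ?P = "\<lambda>\<theta>. \<theta> \<in> Rn n \<and> Diff_norm1 n r \<theta> \<le> V * real n powi (1 - int r)"
  have "\<exists>u. is_arg_min (\<lambda>\<theta>. 1 / 2 * sq_dist n Y \<theta>) ?P u"
    using feasible_minimiser_exists[OF assms, of Y]
    by (auto simp: is_arg_min_def feasible_def not_less)
  then have "is_arg_min (\<lambda>\<theta>. 1 / 2 * sq_dist n Y \<theta>) ?P (trend_filter n r V Y)"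
    unfolding trend_filter_def arg_min_def by (rule someI_ex)
  then show "trend_filter n r V Y \<in> feasible n r (V * real n powi (1 - int r))"
    "v \<in> feasible n r (V * real n powi (1 - int r)) \<Longrightarrow> sq_dist n Y (trend_filter n r V Y) \<le> sq_dist n Y v"
    by (auto simp: is_arg_min_def feasible_def not_less)
qed

lemma ip_linear_expand:
  "ip n (\<lambda>i. a i - t * d i) (\<lambda>i. a i - t * d i) = ip n a a - 2 * t * ip n a d + t\<^sup>2 * ip n d d"
  unfolding ip_def sum_distrib_left
  by (simp add: sum_subtractf[symmetric] sum.distrib[symmetric] power2_eq_square algebra_simps)

text \<open>
  The first-order optimality condition of a projection onto a convex set, obtained by moving from the
  minimiser towards \<open>v\<close> by a small step.
\<close>
lemma trend_filter_variational:
  assumes v: "v \<in> feasible n r (V * real n powi (1 - int r))"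
  shows "ip n (\<lambda>i. Y i - trend_filter n r V Y i) (\<lambda>i. v i - trend_filter n r V Y i) \<le> 0"
proof (rule ccontr)
  let ?K = "feasible n r (V * real n powi (1 - int r))"
  define u where "u = trend_filter n r V Y"
  define a where "a = (\<lambda>i. Y i - u i)"
  define d where "d = (\<lambda>i. v i - u i)"
  assume "\<not> ?thesis"
  then have pos: "0 < ip n a d" by (simp add: u_def a_def d_def)
  have u: "u \<in> ?K" "\<And>x. x \<in> ?K \<Longrightarrow> sq_dist n Y u \<le> sq_dist n Y x"
    unfolding u_def using v trend_filter_minimises by blast+
  have key: "2 * ip n a d \<le> t * ip n d d" if t: "0 < t" "t \<le> 1" for t
  proof -
    let ?x = "restrict (\<lambda>i. (1 - t) * u i + t * v i) {..<n}"
    have "ip n a a \<le> sq_dist n Y ?x"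
      using u(2)[OF feasible_convex[OF u(1) v]] t by (simp add: sq_dist_eq_ip a_def)
    also have "\<dots> = ip n (\<lambda>i. a i - t * d i) (\<lambda>i. a i - t * d i)"
      unfolding sq_dist_eq_ip by (intro ip_cong) (auto simp: a_def d_def algebra_simps)
    finally have "t * (2 * ip n a d) \<le> t * (t * ip n d d)"
      by (simp add: ip_linear_expand power2_eq_square mult_ac)
    then show ?thesis using t by simp
  qed
  \<comment> \<open>This step is so short that the quadratic term is smaller than the linear one.\<close>
  define t where "t = min 1 (ip n a d / (ip n d d + 1))"
  have dd: "0 \<le> ip n d d" by (rule ip_self_nonneg)
  have t: "0 < t" "t \<le> 1" using pos dd by (auto simp: t_def)
  have "t * ip n d d \<le> ip n a d / (ip n d d + 1) * ip n d d"
    using dd by (intro mult_right_mono) (auto simp: t_def)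
  also have "\<dots> = ip n a d * (ip n d d / (ip n d d + 1))" by simp
  also have "\<dots> \<le> ip n a d * 1" using pos dd by (intro mult_left_mono) auto
  finally show False using key[OF t] pos by simp
qed

lemma ip_le_L2: "ip n u v \<le> sqrt (ip n u u) * sqrt (ip n v v)"
proof -
  have "ip n u v \<le> (\<Sum>i<n. \<bar>u i\<bar> * \<bar>v i\<bar>)"
    unfolding ip_def by (intro sum_mono) (metis abs_ge_self abs_mult)
  also have "\<dots> \<le> L2_set u {..<n} * L2_set v {..<n}" by (rule L2_set_mult_ineq)
  finally show ?thesis by (simp add: L2_set_def ip_def power2_eq_square)
qed

text \<open>
  Adding the optimality conditions of the two projections, each tested with the other projection.
\<close>
lemma trend_filter_nonexpansive:
  assumes ne: "feasible n r (V * real n powi (1 - int r)) \<noteq> {}"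
  shows "sq_dist n (trend_filter n r V Y) (trend_filter n r V Y') \<le> sq_dist n Y Y'"
proof -
  define u u' where "u = trend_filter n r V Y" and "u' = trend_filter n r V Y'"
  have 1: "ip n (\<lambda>i. Y i - u i) (\<lambda>i. u' i - u i) \<le> 0"
    unfolding u_def u'_def by (intro trend_filter_variational trend_filter_minimises ne)
  have 2: "ip n (\<lambda>i. Y' i - u' i) (\<lambda>i. u i - u' i) \<le> 0"
    unfolding u_def u'_def by (intro trend_filter_variational trend_filter_minimises ne)
  let ?d = "\<lambda>i. u i - u' i" and ?y = "\<lambda>i. Y i - Y' i"
  have "ip n ?d ?d - ip n ?y ?d = ip n (\<lambda>i. Y i - u i) (\<lambda>i. u' i - u i) + ip n (\<lambda>i. Y' i - u' i) (\<lambda>i. u i - u' i)"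
    unfolding ip_def by (simp add: sum_subtractf[symmetric] sum.distrib[symmetric] algebra_simps)
  then have "ip n ?d ?d \<le> ip n ?y ?d" using 1 2 by linarith
  also have "\<dots> \<le> sqrt (ip n ?y ?y) * sqrt (ip n ?d ?d)" by (rule ip_le_L2)
  finally have *: "sqrt (ip n ?d ?d) * sqrt (ip n ?d ?d) \<le> sqrt (ip n ?y ?y) * sqrt (ip n ?d ?d)"
    using ip_self_nonneg[of n ?d] by simp
  have "sqrt (ip n ?d ?d) \<le> sqrt (ip n ?y ?y)"
  proof (cases "0 < sqrt (ip n ?d ?d)")
    case True
    then show ?thesis by (rule mult_right_le_imp_le[OF *])
  next
    case False
    then have "sqrt (ip n ?d ?d) \<le> 0" by linarith
    also have "\<dots> \<le> sqrt (ip n ?y ?y)" using ip_self_nonneg[of n ?y] by simp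
    finally show ?thesis .
  qed
  then show ?thesis by (simp add: sq_dist_eq_ip u_def u'_def)
qed

text \<open>
  By nonexpansiveness each coordinate of the estimator is continuous for the product topology on all
  sequences, whose Borel sets are generated by the coordinates.  The estimator at \<open>Y\<close> depends only on
  the coordinates of \<open>Y\<close> below \<open>n\<close>, which transfers measurability to the finite product.
\<close>
lemma trend_filter_measurable:
  assumes ne: "feasible n r (V * real n powi (1 - int r)) \<noteq> {}" and i: "i < n"
  shows "(\<lambda>Y. trend_filter n r V Y i) \<in> borel_measurable (\<Pi>\<^sub>M i\<in>{..<n}. borel)"
proof -
  define F where "F = (\<lambda>Y. trend_filter n r V Y i)"
  have bound: "\<bar>F Y - F Y'\<bar> \<le> sqrt (sq_dist n Y Y')" for Y Y'
  proof -
    let ?d = "\<lambda>i. trend_filter n r V Y i - trend_filter n r V Y' i"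
    have "(?d i)\<^sup>2 \<le> ip n ?d ?d"
      unfolding ip_def power2_eq_square[symmetric] by (rule member_le_sum) (use i in auto)
    also have "\<dots> \<le> sq_dist n Y Y'"
      using trend_filter_nonexpansive[OF ne] by (simp add: sq_dist_eq_ip)
    finally show ?thesis unfolding F_def by (rule real_le_rsqrt[of "\<bar>_\<bar>", simplified])
  qed
  have "continuous_on UNIV F"
  proof (unfold continuous_on_def, intro ballI)
    fix Y :: "nat \<Rightarrow> real"
    have "continuous_on UNIV (\<lambda>Y'. sqrt (sq_dist n Y' Y))"
      unfolding sq_dist_eq_ip ip_def
      by (intro continuous_intros continuous_on_coordinate)
    then have "((\<lambda>Y'. sqrt (sq_dist n Y' Y)) \<longlongrightarrow> sqrt (sq_dist n Y Y)) (at Y)"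
      by (simp add: continuous_on_def)
    then have "((\<lambda>Y'. sqrt (sq_dist n Y' Y)) \<longlongrightarrow> 0) (at Y)"
      by (simp add: sq_dist_eq_ip ip_def)
    then have "((\<lambda>Y'. F Y' - F Y) \<longlongrightarrow> 0) (at Y)"
      by (rule Lim_null_comparison[rotated]) (simp add: bound)
    then show "(F \<longlongrightarrow> F Y) (at Y within UNIV)" by (simp add: LIM_zero_iff)
  qed
  then have F: "F \<in> borel_measurable borel" by (rule borel_measurable_continuous_onI)
  let ?e = "\<lambda>Y j. if j < n then Y j else (undefined :: real)"
  have "?e \<in> borel_measurable (\<Pi>\<^sub>M i\<in>{..<n}. borel)"
  proof (rule measurable_coordinatewise_then_product)
    fix j show "(\<lambda>Y. if j < n then Y j else undefined) \<in> borel_measurable (\<Pi>\<^sub>M i\<in>{..<n}. (borel :: real measure))"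
      by (cases "j < n") auto
  qed
  then have "(\<lambda>Y. F (?e Y)) \<in> borel_measurable (\<Pi>\<^sub>M i\<in>{..<n}. borel)"
    using F by (rule measurable_compose)
  moreover have "F (?e Y) = F Y" for Y
    using bound[of "?e Y" Y] by (simp add: sq_dist_eq_ip ip_def)
  ultimately show ?thesis by (simp add: F_def)
qed

lemma sq_dist_trend_filter_measurable:
  assumes "feasible n r (V * real n powi (1 - int r)) \<noteq> {}"
  shows "(\<lambda>Y. sq_dist n (trend_filter n r V Y) \<theta>) \<in> borel_measurable (gaussian_vec n \<theta> \<sigma>)"
proof -
  note [measurable] = trend_filter_measurable[OF assms]
  have "(\<lambda>Y. \<Sum>i<n. (trend_filter n r V Y i - \<theta> i) * (trend_filter n r V Y i - \<theta> i))
      \<in> borel_measurable (\<Pi>\<^sub>M i\<in>{..<n}. borel)"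
    by (rule borel_measurable_sum) auto
  then show ?thesis
    unfolding sq_dist_eq_ip ip_def by (subst measurable_cong_sets[OF sets_gaussian_vec refl])
qed

text \<open>
  The optimality condition tested with the true parameter, which is feasible.
\<close>
lemma basic_inequality:
  assumes "\<theta> \<in> feasible n r (V * real n powi (1 - int r))"
  shows "sq_dist n (trend_filter n r V Y) \<theta> \<le> ip n (noise \<theta> Y) (\<lambda>i. trend_filter n r V Y i - \<theta> i)"
proof -
  define u where "u = trend_filter n r V Y"
  have "ip n (\<lambda>i. Y i - u i) (\<lambda>i. \<theta> i - u i) \<le> 0"
    unfolding u_def by (rule trend_filter_variational[OF assms])
  moreover have "ip n (\<lambda>i. u i - \<theta> i) (\<lambda>i. u i - \<theta> i) - ip n (noise \<theta> Y) (\<lambda>i. u i - \<theta> i)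
      = ip n (\<lambda>i. Y i - u i) (\<lambda>i. \<theta> i - u i)"
    unfolding ip_def noise_def by (simp add: sum_subtractf[symmetric] algebra_simps)
  ultimately show ?thesis by (simp add: sq_dist_eq_ip u_def)
qed

section \<open>Thresholding the noise\<close>

text \<open>
  The part of a noise coefficient above its threshold is paired with the coefficient of \<open>u\<close> by
  \<open>2 * m * c \<le> m\<^sup>2 + c\<^sup>2\<close>, and the squares \<open>c\<^sup>2\<close> add up to one copy of the squared norm of \<open>u\<close>, which is
  absorbed on the left.  This leaves the factor 1 in front of the noise term: it is what makes the
  constant 4 in the deviation bound possible.
\<close>
lemma threshold_bound:
  assumes W: "ortho_system n W w"
    and complete: "\<And>u. (\<And>k. k \<in> W \<Longrightarrow> ip n u (w k) = 0) \<Longrightarrow> \<forall>i<n. u i = 0"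
    and basic: "ip n u u \<le> ip n e u"
  shows "ip n u u \<le> (\<Sum>k\<in>W. (max 0 (\<bar>ip n e (w k)\<bar> - \<tau> k))\<^sup>2) + 2 * (\<Sum>k\<in>W. \<tau> k * \<bar>ip n u (w k)\<bar>)"
proof -
  define z c where "z = (\<lambda>k. ip n e (w k))" and "c = (\<lambda>k. ip n u (w k))"
  have "2 * (z k * c k) \<le> (max 0 (\<bar>z k\<bar> - \<tau> k))\<^sup>2 + (c k)\<^sup>2 + 2 * (\<tau> k * \<bar>c k\<bar>)" for k
  proof -
    let ?m = "max 0 (\<bar>z k\<bar> - \<tau> k)"
    have "z k * c k \<le> \<bar>z k\<bar> * \<bar>c k\<bar>" by (metis abs_ge_self abs_mult)
    also have "\<dots> \<le> (?m + \<tau> k) * \<bar>c k\<bar>" by (intro mult_right_mono) auto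
    finally have "z k * c k \<le> ?m * \<bar>c k\<bar> + \<tau> k * \<bar>c k\<bar>" by (simp add: distrib_right)
    moreover have "2 * (?m * \<bar>c k\<bar>) \<le> ?m\<^sup>2 + (c k)\<^sup>2"
      using sum_squares_bound[of ?m "\<bar>c k\<bar>"] by simp
    ultimately show ?thesis by linarith
  qed
  then have "(\<Sum>k\<in>W. 2 * (z k * c k)) \<le> (\<Sum>k\<in>W. (max 0 (\<bar>z k\<bar> - \<tau> k))\<^sup>2 + (c k)\<^sup>2 + 2 * (\<tau> k * \<bar>c k\<bar>))"
    by (intro sum_mono)
  also have "\<dots> = (\<Sum>k\<in>W. (max 0 (\<bar>z k\<bar> - \<tau> k))\<^sup>2) + (\<Sum>k\<in>W. (c k)\<^sup>2) + 2 * (\<Sum>k\<in>W. \<tau> k * \<bar>c k\<bar>)"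
    by (simp add: sum.distrib sum_distrib_left)
  also have "(\<Sum>k\<in>W. (c k)\<^sup>2) = ip n u u"
    using ortho_system_expansion[OF W complete, of u u] by (simp add: c_def power2_eq_square)
  also have "(\<Sum>k\<in>W. 2 * (z k * c k)) = 2 * ip n e u"
    using ortho_system_expansion[OF W complete, of e u] by (simp add: z_def c_def sum_distrib_left)
  finally show ?thesis using basic by (simp add: z_def c_def)
qed

text \<open>
  The thresholds must grow with the distance \<open>s - p\<close> to the coarsest scale fast enough for
  \<open>exp (- \<tau>\<^sup>2 / (4 * \<sigma>\<^sup>2))\<close> to beat the number \<open>n / 2 ^ p\<close> of blocks, and slowly enough not to spoil the
  geometric decay of the detail coefficients.  Linear growth does both.
\<close>
fun threshold :: "nat \<Rightarrow> real \<Rightarrow> nat \<Rightarrow> nat \<times> nat \<times> nat \<Rightarrow> real" where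
  "threshold r \<sigma> s (p, m, k) = (if k < r then 0 else 2 * \<sigma> * real (s - p + 1))"

lemma sum_indices:
  "finite P \<Longrightarrow> (\<And>p. finite (A p)) \<Longrightarrow> finite B \<Longrightarrow>
    (\<Sum>x\<in>(SIGMA p:P. A p \<times> B). f x) = (\<Sum>p\<in>P. \<Sum>m\<in>A p. \<Sum>k\<in>B. f (p, m, k))"
  by (simp add: sum.Sigma sum.cartesian_product split_def)

lemma sum_coarse_detail:
  "(\<Sum>x\<in>coarse_indices n r s \<union> detail_indices n r s. f x)
    = (\<Sum>m\<le>n div 2 ^ s. \<Sum>k<r. f (s, m, k)) + (\<Sum>p=1..s. \<Sum>m\<le>n div 2 ^ p. \<Sum>k=r..<2 * r. f (p, m, k))"
proof -
  have "coarse_indices n r s \<inter> detail_indices n r s = {}"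
    by (auto simp: coarse_indices_def detail_indices_def)
  moreover have "sum f (coarse_indices n r s) = (\<Sum>m\<le>n div 2 ^ s. \<Sum>k<r. f (s, m, k))"
    unfolding coarse_indices_def by (subst sum_indices) auto
  moreover have "sum f (detail_indices n r s) = (\<Sum>p=1..s. \<Sum>m\<le>n div 2 ^ p. \<Sum>k=r..<2 * r. f (p, m, k))"
    unfolding detail_indices_def by (subst sum_indices) auto
  ultimately show ?thesis
    by (subst sum.union_disjoint) (auto simp: finite_coarse_indices finite_detail_indices)
qed

lemma sum_scales_reindex:
  fixes g :: "nat \<Rightarrow> real"
  shows "(\<Sum>p=1..s. g (s - p)) = (\<Sum>j<s. g j)"
proof -
  have "(\<Sum>p=1..s. g (s - p)) = (\<Sum>j<s. g (s - Suc j))"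
    using sum.atLeast1_atMost_eq[of "\<lambda>p. g (s - p)" s] by simp
  also have "\<dots> = (\<Sum>j<s. g j)" by (rule sum.nat_diff_reindex)
  finally show ?thesis .
qed

lemma sum_half_powers_le: "(\<Sum>j<s. (1 / 2 :: real) ^ j) \<le> 2"
proof -
  have "(\<Sum>j<s. (1 / 2 :: real) ^ j) = 2 - 2 * (1 / 2) ^ s"
    by (induction s) auto
  then show ?thesis by simp
qed

text \<open>
  Multiplied by \<open>(1 - x)\<^sup>2\<close> the sum telescopes; for \<open>x = 1 / sqrt 2\<close> this factor is at least \<open>1 / 12\<close>.
\<close>
lemma sum_arith_geometric_le: "(\<Sum>j<s. real (j + 1) * (1 / sqrt 2) ^ j) \<le> 12"
proof -
  define x :: real where "x = 1 / sqrt 2"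
  have "1.41 \<le> sqrt (2 :: real)" by (rule real_le_rsqrt) (simp add: power2_eq_square)
  then have x: "0 \<le> x" "x \<le> 100 / 141" by (auto simp: x_def field_simps)
  have "(1 - x)\<^sup>2 * (\<Sum>j<s. real (j + 1) * x ^ j) = 1 - real (s + 1) * x ^ s + real s * x ^ (s + 1)"
    by (induction s) (auto simp: algebra_simps power2_eq_square)
  also have "\<dots> \<le> 1"
  proof -
    have "x ^ (s + 1) \<le> x ^ s" using x by (intro power_decreasing) auto
    then have "real s * x ^ (s + 1) \<le> real (s + 1) * x ^ s"
      using x by (intro mult_mono) auto
    then show ?thesis by simp
  qed
  finally have le1: "(1 - x)\<^sup>2 * (\<Sum>j<s. real (j + 1) * x ^ j) \<le> 1" .
  have "(41 / 141 :: real)\<^sup>2 \<le> (1 - x)\<^sup>2" using x by (intro power_mono) auto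
  then have "1 / 12 \<le> (1 - x)\<^sup>2" by (simp add: power2_eq_square)
  then have "1 / 12 * (\<Sum>j<s. real (j + 1) * x ^ j) \<le> (1 - x)\<^sup>2 * (\<Sum>j<s. real (j + 1) * x ^ j)"
    using x by (intro mult_right_mono) (auto intro!: sum_nonneg)
  then show ?thesis using le1 by (simp add: x_def)
qed

lemma block_count_le:
  assumes "p \<le> s" "2 ^ s \<le> n"
  shows "real (n div 2 ^ p + 1) \<le> 2 * real n / 2 ^ p"
proof -
  have "(2 :: nat) ^ p \<le> 2 ^ s" using assms by (intro power_increasing) auto
  then have "2 ^ p \<le> n" using assms(2) by (rule order_trans)
  then have "1 \<le> n div 2 ^ p" by (simp add: div_greater_zero_iff Suc_le_eq)
  then have "real (n div 2 ^ p + 1) \<le> 2 * real (n div 2 ^ p)" by simp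
  also have "\<dots> \<le> 2 * (real n / 2 ^ p)"
  proof -
    have "n div 2 ^ p * 2 ^ p \<le> n" by (rule div_times_less_eq_dividend)
    then have "real (n div 2 ^ p * 2 ^ p) \<le> real n" by (simp only: of_nat_le_iff)
    then show ?thesis by (simp add: field_simps)
  qed
  finally show ?thesis by simp
qed

lemma exp_neg_square_le: "exp (- (real (j + 1))\<^sup>2) \<le> (1 / 4) ^ j"
proof -
  have "2 * real j \<le> (real (j + 1))\<^sup>2" by (simp add: power2_eq_square algebra_simps)
  then have "exp (- (real (j + 1))\<^sup>2) \<le> exp (- (real j * 2))" by simp
  also have "\<dots> = (1 / exp 2) ^ j" by (simp add: exp_of_nat_mult exp_minus power_one_over inverse_eq_divide)
  also have "\<dots> \<le> (1 / 4) ^ j"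
  proof (rule power_mono)
    have "(2 :: real) * 2 \<le> exp 1 * exp 1" using exp_ge_add_one_self[of 1] by (intro mult_mono) auto
    also have "\<dots> = exp 2" by (simp add: exp_add[symmetric])
    finally show "1 / exp 2 \<le> (1 / 4 :: real)" by (simp add: field_simps)
  qed simp
  finally show ?thesis .
qed

text \<open>
  At scale \<open>p\<close> there are of the order of \<open>n / 2 ^ p\<close> blocks, each with a weight of order at most
  \<open>(1 / 4) ^ (s - p)\<close>.  Hence the contributions decay geometrically below scale \<open>s\<close>.
\<close>
lemma threshold_weight_sum_le:
  assumes \<sigma>: "0 < \<sigma>" and s: "2 ^ s \<le> n"
  shows "(\<Sum>x\<in>coarse_indices n r s \<union> detail_indices n r s. 2 * exp (- (threshold r \<sigma> s x)\<^sup>2 / (4 * \<sigma>\<^sup>2)))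
    \<le> 12 * real r * real n / 2 ^ s"
proof -
  let ?q = "\<lambda>x. 2 * exp (- (threshold r \<sigma> s x)\<^sup>2 / (4 * \<sigma>\<^sup>2))"
  have "(\<Sum>m\<le>n div 2 ^ s. \<Sum>k<r. ?q (s, m, k)) = 2 * real r * real (n div 2 ^ s + 1)"
    by simp
  also have "\<dots> \<le> 2 * real r * (2 * real n / 2 ^ s)"
    by (intro mult_left_mono block_count_le[OF order_refl s]) auto
  finally have coarse: "(\<Sum>m\<le>n div 2 ^ s. \<Sum>k<r. ?q (s, m, k)) \<le> 4 * real r * real n / 2 ^ s"
    by simp
  have "(\<Sum>p=1..s. \<Sum>m\<le>n div 2 ^ p. \<Sum>k=r..<2 * r. ?q (p, m, k))
      \<le> (\<Sum>p=1..s. 4 * real r * real n / 2 ^ s * (1 / 2) ^ (s - p))"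
  proof (intro sum_mono)
    fix p assume p: "p \<in> {1..s}"
    have "(\<Sum>m\<le>n div 2 ^ p. \<Sum>k=r..<2 * r. ?q (p, m, k))
        = (\<Sum>m\<le>n div 2 ^ p. \<Sum>k=r..<2 * r. 2 * exp (- (real (s - p + 1))\<^sup>2))"
    proof (intro sum.cong refl)
      fix m k assume "k \<in> {r..<2 * r}"
      moreover have "(2 * \<sigma> * real (s - p + 1))\<^sup>2 / (4 * \<sigma>\<^sup>2) = (real (s - p + 1))\<^sup>2"
        using \<sigma> by (simp add: power_mult_distrib)
      ultimately show "?q (p, m, k) = 2 * exp (- (real (s - p + 1))\<^sup>2)" by simp
    qed
    also have "\<dots> = 2 * real r * (real (n div 2 ^ p + 1) * exp (- (real (s - p + 1))\<^sup>2))" by simp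
    also have "\<dots> \<le> 2 * real r * ((2 * real n / 2 ^ p) * (1 / 4) ^ (s - p))"
      by (intro mult_left_mono mult_mono block_count_le[OF _ s] exp_neg_square_le) (use p in auto)
    also have "(2 :: real) ^ s = 2 ^ p * 2 ^ (s - p)" using p by (simp add: power_add[symmetric])
    then have "2 * real r * ((2 * real n / 2 ^ p) * (1 / 4) ^ (s - p)) = 4 * real r * real n / 2 ^ s * (1 / 2) ^ (s - p)"
      by (simp add: power_divide field_simps power_mult_distrib[symmetric])
    finally show "(\<Sum>m\<le>n div 2 ^ p. \<Sum>k=r..<2 * r. ?q (p, m, k))
        \<le> 4 * real r * real n / 2 ^ s * (1 / 2) ^ (s - p)" .
  qed
  also have "\<dots> = 4 * real r * real n / 2 ^ s * (\<Sum>j<s. (1 / 2) ^ j)"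
    unfolding sum_scales_reindex[symmetric] sum_distrib_left ..
  also have "\<dots> \<le> 4 * real r * real n / 2 ^ s * 2"
    by (intro mult_left_mono sum_half_powers_le) auto
  finally show ?thesis using coarse unfolding sum_coarse_detail by (simp add: field_simps)
qed

text \<open>
  The blocks of one scale are disjoint, so the bounds of their detail coefficients add up to the full
  variation of order \<open>r\<close>.  Relative to scale \<open>s\<close>, scale \<open>p\<close> gains at least the factor
  \<open>(1 / sqrt 2) ^ (s - p)\<close>, with equality for \<open>r = 1\<close>.
\<close>
lemma threshold_bias_le:
  assumes r: "1 \<le> r" and \<sigma>: "0 < \<sigma>"
  shows "(\<Sum>x\<in>coarse_indices n r s \<union> detail_indices n r s. threshold r \<sigma> s x * \<bar>ip n f (multiwavelet n r x)\<bar>)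
    \<le> (if s = 0 then 0 else 24 * \<sigma> * real r * sqrt (2 ^ s) * (2 ^ s) ^ (r - 1) * Diff_norm1 n r f)"
proof -
  define A where "A = 2 * \<sigma> * real r * sqrt (2 ^ s) * (2 ^ s) ^ (r - 1) * Diff_norm1 n r f"
  have D0: "0 \<le> Diff_norm1 n r f" by (simp add: Diff_norm1_def sum_nonneg)
  then have A0: "0 \<le> A" using \<sigma> by (simp add: A_def)
  have scale: "(\<Sum>m\<le>n div 2 ^ p. \<Sum>k=r..<2 * r. threshold r \<sigma> s (p, m, k) * \<bar>ip n f (multiwavelet n r (p, m, k))\<bar>)
      \<le> A * (real (s - p + 1) * (1 / sqrt 2) ^ (s - p))" if p: "1 \<le> p" "p \<le> s" for p
  proof -
    define L where "L = sqrt (2 ^ p) * (2 ^ p) ^ (r - 1)"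
    define S where "S = (\<lambda>m. \<Sum>j | j < n - r \<and> j div 2 ^ p = m. \<bar>Diff r f j\<bar>)"
    have "(\<Sum>m\<le>n div 2 ^ p. \<Sum>k=r..<2 * r. threshold r \<sigma> s (p, m, k) * \<bar>ip n f (multiwavelet n r (p, m, k))\<bar>)
        \<le> (\<Sum>m\<le>n div 2 ^ p. \<Sum>k=r..<2 * r. 2 * \<sigma> * real (s - p + 1) * (L * S m))"
    proof (intro sum_mono)
      fix m k assume k: "k \<in> {r..<2 * r}"
      then have "\<bar>ip n f (multiwavelet n r (p, m, k))\<bar> \<le> L * S m"
        unfolding L_def S_def using detail_coeff_bound[OF r p(1)] by simp
      then show "threshold r \<sigma> s (p, m, k) * \<bar>ip n f (multiwavelet n r (p, m, k))\<bar> \<le> 2 * \<sigma> * real (s - p + 1) * (L * S m)"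
        using k \<sigma> by (simp del: multiwavelet.simps add: mult_left_mono)
    qed
    also have "\<dots> = 2 * \<sigma> * real (s - p + 1) * real r * L * (\<Sum>m\<le>n div 2 ^ p. S m)"
      unfolding sum_distrib_left by (simp add: mult_ac)
    also have "(\<Sum>m\<le>n div 2 ^ p. S m) = Diff_norm1 n r f"
    proof -
      have "(\<lambda>j. j div 2 ^ p) ` {..<n - r} \<subseteq> {..n div 2 ^ p}" by (auto intro!: div_le_mono)
      from sum.group[OF _ _ this, of "\<lambda>j. \<bar>Diff r f j\<bar>"] show ?thesis
        by (simp add: S_def Diff_norm1_def)
    qed
    also have "2 * \<sigma> * real (s - p + 1) * real r * L * Diff_norm1 n r f
        \<le> 2 * \<sigma> * real (s - p + 1) * real r * (sqrt (2 ^ s) * (1 / sqrt 2) ^ (s - p) * (2 ^ s) ^ (r - 1)) * Diff_norm1 n r f"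
    proof -
      have "sqrt (2 ^ s) = sqrt (2 ^ p) * sqrt 2 ^ (s - p)"
        using p by (simp add: real_sqrt_mult[symmetric] real_sqrt_power[symmetric] power_add[symmetric])
      then have "sqrt (2 ^ p) = sqrt (2 ^ s) * (1 / sqrt 2) ^ (s - p)"
        by (simp add: power_divide)
      moreover have "((2 :: real) ^ p) ^ (r - 1) \<le> (2 ^ s) ^ (r - 1)"
        using p by (intro power_mono power_increasing) auto
      ultimately have "L \<le> sqrt (2 ^ s) * (1 / sqrt 2) ^ (s - p) * (2 ^ s) ^ (r - 1)"
        unfolding L_def by (simp add: mult_left_mono)
      then show ?thesis using \<sigma> D0 by (intro mult_right_mono mult_left_mono) auto
    qed
    finally show ?thesis by (simp only: A_def mult_ac)
  qed
  have "(\<Sum>x\<in>coarse_indices n r s \<union> detail_indices n r s. threshold r \<sigma> s x * \<bar>ip n f (multiwavelet n r x)\<bar>)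
      = (\<Sum>p=1..s. \<Sum>m\<le>n div 2 ^ p. \<Sum>k=r..<2 * r. threshold r \<sigma> s (p, m, k) * \<bar>ip n f (multiwavelet n r (p, m, k))\<bar>)"
    unfolding sum_coarse_detail by (simp del: multiwavelet.simps)
  also have "\<dots> \<le> (\<Sum>p=1..s. A * (real (s - p + 1) * (1 / sqrt 2) ^ (s - p)))"
    by (intro sum_mono scale) auto
  also have "\<dots> = (\<Sum>j<s. A * (real (j + 1) * (1 / sqrt 2) ^ j))"
    by (rule sum_scales_reindex)
  also have "\<dots> = A * (\<Sum>j<s. real (j + 1) * (1 / sqrt 2) ^ j)"
    by (simp only: sum_distrib_left)
  also have "\<dots> \<le> (if s = 0 then 0 else A * 12)"
    using A0 sum_arith_geometric_le[of s] by (auto intro: mult_left_mono)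
  finally show ?thesis by (simp add: A_def mult_ac split: if_splits)
qed

section \<open>The exponential moment of the loss\<close>

text \<open>
  The first term of \<open>T\<close> pays for the noise on the piecewise polynomials of scale \<open>s\<close>, the second one for
  the thresholds on the finer scales, for an error of variation at most twice that of the constraint.  The
  second term is absent if \<open>s = 0\<close>: then the blocks are single points and there are no detail functions.
\<close>
lemma exp_moment_trend_filter:
  fixes n r s :: nat
  assumes r: "1 \<le> r" and n: "0 < n" and \<sigma>: "0 < \<sigma>" and \<theta>: "\<theta> \<in> Rn n"
    and V: "real n ^ (r - 1) * Diff_norm1 n r \<theta> \<le> V" and s: "2 ^ s \<le> n"
    and T: "48 * real r * \<sigma>\<^sup>2 * real n / 2 ^ s
      + (if s = 0 then 0 else 96 * \<sigma> * real r * sqrt (2 ^ s) * (2 ^ s) ^ (r - 1) * (V / real n ^ (r - 1))) \<le> T"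
  shows "(\<integral>\<^sup>+ Y. ennreal (exp ((sq_dist n (trend_filter n r V Y) \<theta> - T) / (4 * \<sigma>\<^sup>2))) \<partial>gaussian_vec n \<theta> \<sigma>) \<le> 1"
    and "\<theta> \<in> feasible n r (V * real n powi (1 - int r))"
proof -
  define b where "b = V / real n ^ (r - 1)"
  have b: "V * real n powi (1 - int r) = b"
    using r n by (simp add: b_def power_int_def nat_diff_distrib power_inverse divide_inverse)
  have \<theta>b: "Diff_norm1 n r \<theta> \<le> b"
    using V n by (simp add: b_def field_simps)
  then have mem: "\<theta> \<in> feasible n r (V * real n powi (1 - int r))"
    unfolding b using \<theta> by (simp add: feasible_def)
  then show "\<theta> \<in> feasible n r (V * real n powi (1 - int r))" .
  define W where "W = coarse_indices n r s \<union> detail_indices n r s"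
  define Q where "Q = (\<Sum>x\<in>W. 2 * exp (- (threshold r \<sigma> s x)\<^sup>2 / (4 * \<sigma>\<^sup>2)))"
  define Z where "Z = (\<lambda>Y. \<Sum>x\<in>W. (max 0 (\<bar>ip n (noise \<theta> Y) (multiwavelet n r x)\<bar> - threshold r \<sigma> s x))\<^sup>2)"
  have W: "ortho_system n W (multiwavelet n r)" unfolding W_def by (rule multiwavelet_ortho_system)
  have loss: "sq_dist n (trend_filter n r V Y) \<theta> \<le> Z Y + (T - 4 * \<sigma>\<^sup>2 * Q)" for Y
  proof -
    define u where "u = (\<lambda>i. trend_filter n r V Y i - \<theta> i)"
    have sq: "sq_dist n (trend_filter n r V Y) \<theta> = ip n u u" by (simp add: sq_dist_eq_ip u_def)
    have "ip n u u \<le> Z Y + 2 * (\<Sum>x\<in>W. threshold r \<sigma> s x * \<bar>ip n u (multiwavelet n r x)\<bar>)"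
      unfolding Z_def
    proof (rule threshold_bound[OF W])
      show "\<forall>i<n. v i = 0" if "\<And>k. k \<in> W \<Longrightarrow> ip n v (multiwavelet n r k) = 0" for v
        using multiwavelet_complete[OF r] that unfolding W_def by blast
      show "ip n u u \<le> ip n (noise \<theta> Y) u"
        using basic_inequality[OF mem, of Y] by (simp add: sq u_def sq_dist_eq_ip)
    qed
    moreover have Du: "Diff_norm1 n r u \<le> 2 * b"
    proof -
      have "Diff_norm1 n r (trend_filter n r V Y) \<le> b"
        using trend_filter_minimises(1)[of n r V Y] mem unfolding b by (auto simp: feasible_def)
      then show ?thesis using Diff_norm1_diff[of n r "trend_filter n r V Y" \<theta>] \<theta>b by (simp add: u_def)
    qed
    have "(if s = 0 then 0 else 24 * \<sigma> * real r * sqrt (2 ^ s) * (2 ^ s) ^ (r - 1) * Diff_norm1 n r u)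
        \<le> (if s = 0 then 0 else 24 * \<sigma> * real r * sqrt (2 ^ s) * (2 ^ s) ^ (r - 1) * (2 * b))"
    proof (cases "s = 0")
      case False
      then show ?thesis
        unfolding if_not_P[OF False] using \<sigma> Du by (intro mult_left_mono) auto
    qed simp
    from order_trans[OF threshold_bias_le[OF r \<sigma>, where n = n and s = s and f = u] this]
    have "2 * (\<Sum>x\<in>W. threshold r \<sigma> s x * \<bar>ip n u (multiwavelet n r x)\<bar>)
        \<le> (if s = 0 then 0 else 96 * \<sigma> * real r * sqrt (2 ^ s) * (2 ^ s) ^ (r - 1) * b)"
      unfolding W_def by (cases "s = 0") (auto simp: mult_ac)
    moreover have "4 * \<sigma>\<^sup>2 * Q \<le> 4 * \<sigma>\<^sup>2 * (12 * real r * real n / 2 ^ s)"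
      unfolding Q_def W_def by (intro mult_left_mono threshold_weight_sum_le \<sigma> s) auto
    ultimately show ?thesis using T unfolding sq b_def by (simp add: algebra_simps)
  qed
  have "(sq_dist n (trend_filter n r V Y) \<theta> - T) / (4 * \<sigma>\<^sup>2) \<le> - Q + Z Y / (4 * \<sigma>\<^sup>2)" for Y
  proof -
    have "(sq_dist n (trend_filter n r V Y) \<theta> - T) / (4 * \<sigma>\<^sup>2) \<le> (Z Y - 4 * \<sigma>\<^sup>2 * Q) / (4 * \<sigma>\<^sup>2)"
      using loss[of Y] by (intro divide_right_mono) auto
    also have "\<dots> = - Q + Z Y / (4 * \<sigma>\<^sup>2)" using \<sigma> by (simp add: diff_divide_distrib)
    finally show ?thesis .
  qed
  then have "exp ((sq_dist n (trend_filter n r V Y) \<theta> - T) / (4 * \<sigma>\<^sup>2)) \<le> exp (- Q) * exp (Z Y / (4 * \<sigma>\<^sup>2))" for Y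
    by (simp only: exp_add[symmetric] exp_le_cancel_iff)
  then have "(\<integral>\<^sup>+ Y. ennreal (exp ((sq_dist n (trend_filter n r V Y) \<theta> - T) / (4 * \<sigma>\<^sup>2))) \<partial>gaussian_vec n \<theta> \<sigma>)
      \<le> (\<integral>\<^sup>+ Y. ennreal (exp (- Q)) * ennreal (exp (Z Y / (4 * \<sigma>\<^sup>2))) \<partial>gaussian_vec n \<theta> \<sigma>)"
    by (intro nn_integral_mono) (simp add: ennreal_mult[symmetric] ennreal_leI)
  also have "\<dots> = ennreal (exp (- Q)) * (\<integral>\<^sup>+ Y. ennreal (exp (Z Y / (4 * \<sigma>\<^sup>2))) \<partial>gaussian_vec n \<theta> \<sigma>)"
    unfolding Z_def by (rule nn_integral_cmult) measurable
  also have "\<dots> \<le> ennreal (exp (- Q)) * ennreal (exp Q)"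
    unfolding Z_def Q_def using \<sigma>
    by (intro mult_left_mono gaussian_vec_exp_threshold W) auto
  also have "\<dots> = 1" by (simp add: ennreal_mult[symmetric] exp_add[symmetric])
  finally show "(\<integral>\<^sup>+ Y. ennreal (exp ((sq_dist n (trend_filter n r V Y) \<theta> - T) / (4 * \<sigma>\<^sup>2))) \<partial>gaussian_vec n \<theta> \<sigma>) \<le> 1" .
qed

text \<open>
  The expectation follows from \<open>t \<le> exp t - 1\<close>, the deviation bound from Markov's inequality.
\<close>
lemma (in prob_space) exp_moment_consequences:
  fixes F :: "'a \<Rightarrow> real"
  assumes F [measurable]: "F \<in> borel_measurable M" and F0: "\<And>y. 0 \<le> F y" and c: "0 < c"
    and mgf: "(\<integral>\<^sup>+ y. ennreal (exp ((F y - T) / c)) \<partial>M) \<le> 1"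
  shows "integrable M F" and "(\<integral>y. F y \<partial>M) \<le> T"
    and "1 - exp (- x) \<le> prob {y \<in> space M. F y \<le> T + c * x}"
proof -
  define e where "e = (\<lambda>y. exp ((F y - T) / c))"
  have [measurable]: "e \<in> borel_measurable M" unfolding e_def by measurable
  have e: "integrable M e"
    using mgf by (intro integrableI_nonneg) (auto simp: e_def intro: le_less_trans)
  have "ennreal (\<integral>y. e y \<partial>M) \<le> 1"
    using mgf nn_integral_eq_integral[OF e] by (simp add: e_def)
  then have e1: "(\<integral>y. e y \<partial>M) \<le> 1" by simp
  have le: "F y \<le> T - c + c * e y" for y
    using exp_ge_add_one_self[of "(F y - T) / c"] c by (simp add: e_def field_simps)
  have int: "integrable M (\<lambda>y. T - c + c * e y)" using e by simp
  show FI: "integrable M F"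
    by (rule Bochner_Integration.integrable_bound[OF int F]) (use F0 le in \<open>auto simp: abs_of_nonneg order_trans[OF F0 le]\<close>)
  have "(\<integral>y. F y \<partial>M) \<le> (\<integral>y. T - c + c * e y \<partial>M)" by (intro integral_mono FI int le)
  also have "\<dots> = T - c + c * (\<integral>y. e y \<partial>M)" using e by (simp add: prob_space)
  also have "\<dots> \<le> T" using e1 c by simp
  finally show "(\<integral>y. F y \<partial>M) \<le> T" .
  have "prob {y \<in> space M. \<not> F y \<le> T + c * x} \<le> prob {y \<in> space M. exp x \<le> e y}"
  proof (intro finite_measure_mono subsetI)
    fix y assume "y \<in> {y \<in> space M. \<not> F y \<le> T + c * x}"
    then show "y \<in> {y \<in> space M. exp x \<le> e y}" using c by (simp add: e_def field_simps)
  qed measurable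
  also have "\<dots> \<le> (\<integral>y. e y \<partial>M) / exp x"
    by (rule integral_Markov_inequality_measure[OF e sets.top]) (auto simp: e_def)
  also have "\<dots> \<le> exp (- x)" using e1 by (simp add: exp_minus field_simps)
  finally have "prob {y \<in> space M. \<not> F y \<le> T + c * x} \<le> exp (- x)" .
  then show "1 - exp (- x) \<le> prob {y \<in> space M. F y \<le> T + c * x}"
    by (subst (asm) prob_neg) auto
qed

section \<open>Choice of the coarsest scale\<close>

lemma dyadic_floor:
  assumes "1 \<le> (x :: real)"
  shows "\<exists>s :: nat. 2 ^ s \<le> x \<and> x < 2 * 2 ^ s"
proof -
  obtain N where N: "x < 2 ^ N" using real_arch_pow[of 2 x] by auto
  define m where "m = (LEAST N :: nat. x < 2 ^ N)"
  have m: "x < 2 ^ m" unfolding m_def by (rule LeastI[of "\<lambda>N. x < 2 ^ N", OF N])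
  then obtain s where s: "m = Suc s" using assms by (cases m) auto
  have "\<not> x < 2 ^ s" using not_less_Least[of s "\<lambda>N. x < 2 ^ N"] s unfolding m_def by simp
  then show ?thesis using m s by (intro exI[of _ s]) simp
qed

text \<open>
  Both terms are of the same order when \<open>2 ^ s\<close> is close to the number \<open>h\<close> with
  \<open>h powr (r + 1 / 2) = \<sigma> * n ^ r / V\<close>, and there they equal \<open>\<sigma>\<^sup>2 * n / h\<close>, which is \<open>n\<close> times the rate.  If
  \<open>h \<ge> n\<close>, that is \<open>V * sqrt n \<le> \<sigma>\<close>, a bounded number of blocks suffices and the cost is of order
  \<open>\<sigma>\<^sup>2\<close>, which the logarithmic term of the maximum covers; if \<open>h < 1\<close>, the trivial
  bound by the full noise is already of the right order.
\<close>
lemma scale_selection: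
  fixes n r :: nat and \<sigma> V :: real
  assumes r: "1 \<le> r" and n: "1 \<le> n" and \<sigma>: "0 < \<sigma>" and V: "0 \<le> V"
  defines "M \<equiv> max ((\<sigma>\<^sup>2 * V powr (1 / real r) / real n) powr (2 * real r / (2 * real r + 1)))
                   (\<sigma>\<^sup>2 / real n * ln (exp 1 * real n))"
  shows "\<exists>s. 2 ^ s \<le> n \<and> 48 * real r * \<sigma>\<^sup>2 * real n / 2 ^ s
      + (if s = 0 then 0 else 96 * \<sigma> * real r * sqrt (2 ^ s) * (2 ^ s) ^ (r - 1) * (V / real n ^ (r - 1)))
      \<le> 192 * real r * (real n * M)"
proof -
  let ?cost = "\<lambda>s. 48 * real r * \<sigma>\<^sup>2 * real n / 2 ^ s
      + (if s = 0 then 0 else 96 * \<sigma> * real r * sqrt (2 ^ s) * (2 ^ s) ^ (r - 1) * (V / real n ^ (r - 1)))"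
  have n0: "0 < real n" using n by simp
  have cost_le: "?cost s \<le> 192 * real r * R"
    if R: "\<sigma>\<^sup>2 * real n / 2 ^ s \<le> 2 * R" "s \<noteq> 0 \<Longrightarrow> \<sigma> * (sqrt (2 ^ s) * (2 ^ s) ^ (r - 1)) * (V / real n ^ (r - 1)) \<le> R"
    for s R
  proof -
    have R0: "0 \<le> R" using R(1) n0 by (smt (verit) divide_nonneg_nonneg mult_nonneg_nonneg zero_le_power zero_le_power2)
    have "48 * real r * (\<sigma>\<^sup>2 * real n / 2 ^ s) \<le> 48 * real r * (2 * R)"
      by (intro mult_left_mono R) auto
    moreover have "(if s = 0 then 0 else 96 * real r * (\<sigma> * (sqrt (2 ^ s) * (2 ^ s) ^ (r - 1)) * (V / real n ^ (r - 1)))) \<le> 96 * real r * R"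
    proof (cases "s = 0")
      case False
      then show ?thesis unfolding if_not_P[OF False] by (intro mult_left_mono R) auto
    qed (simp add: R0)
    ultimately show ?thesis by (simp add: mult_ac split: if_splits)
  qed
  have half: "sqrt x * x ^ (r - 1) = x powr (real r - 1 / 2)" if "0 < x" for x
  proof -
    have "x powr (real r - 1 / 2) = x powr (1 / 2 + real (r - 1))" using r by (simp add: of_nat_diff)
    then show ?thesis using that by (simp add: powr_add powr_half_sqrt powr_realpow)
  qed
  show ?thesis
  proof (cases "V * sqrt (real n) \<le> \<sigma>")
    case True
    obtain s :: nat where s: "2 ^ s \<le> real n" "real n < 2 * 2 ^ s" using dyadic_floor[of "real n"] n by auto
    have sn: "2 ^ s \<le> n" using s(1) by (metis of_nat_le_iff of_nat_numeral of_nat_power)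
    have "?cost s \<le> 192 * real r * \<sigma>\<^sup>2"
    proof (rule cost_le)
      show "\<sigma>\<^sup>2 * real n / 2 ^ s \<le> 2 * \<sigma>\<^sup>2"
        using s \<sigma> by (simp add: field_simps)
      have "\<sigma> * (sqrt (2 ^ s) * (2 ^ s) ^ (r - 1)) * (V / real n ^ (r - 1))
          \<le> \<sigma> * (sqrt (real n) * real n ^ (r - 1)) * (V / real n ^ (r - 1))"
        using \<sigma> V s by (intro mult_right_mono mult_left_mono mult_mono power_mono) auto
      also have "\<dots> = \<sigma> * (V * sqrt (real n))" using n0 by simp
      also have "\<dots> \<le> \<sigma> * \<sigma>" using True \<sigma> by (intro mult_left_mono) auto
      finally show "\<sigma> * (sqrt (2 ^ s) * (2 ^ s) ^ (r - 1)) * (V / real n ^ (r - 1)) \<le> \<sigma>\<^sup>2"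
        by (simp add: power2_eq_square)
    qed
    also have "\<dots> \<le> 192 * real r * (real n * M)"
    proof (intro mult_left_mono)
      have "\<sigma>\<^sup>2 * 1 \<le> \<sigma>\<^sup>2 * ln (exp 1 * real n)"
        using n by (intro mult_left_mono) (auto simp: ln_mult)
      also have "\<dots> = real n * (\<sigma>\<^sup>2 / real n * ln (exp 1 * real n))" using n0 by simp
      also have "\<dots> \<le> real n * M" unfolding M_def by (intro mult_left_mono) auto
      finally show "\<sigma>\<^sup>2 \<le> real n * M" by simp
    qed auto
    finally show ?thesis using sn by blast
  next
    case False
    then have V0: "0 < V" using V \<sigma> by (cases "V = 0") auto
    define h where "h = (\<sigma> * real n ^ r / V) powr (2 / (2 * real r + 1))"
    define R where "R = \<sigma>\<^sup>2 * real n / h"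
    have h0: "0 < h" using \<sigma> V0 n0 by (simp add: h_def)
    have h_pow: "h powr (real r + 1 / 2) = \<sigma> * real n ^ r / V"
      using \<sigma> V0 n0 by (simp add: h_def powr_powr field_simps)
    have R_rate: "R = real n * (\<sigma>\<^sup>2 * V powr (1 / real r) / real n) powr (2 * real r / (2 * real r + 1))"
    proof -
      define a where "a = 1 / (2 * real r + 1)"
      \<comment> \<open>Compared through logarithms, where the identity becomes linear in \<open>ln \<sigma>\<close>, \<open>ln n\<close> and \<open>ln V\<close>.\<close>
      have ln1: "ln R = 2 * ln \<sigma> + ln n - 2 * a * (ln \<sigma> + real r * ln n - ln V)"
        using \<sigma> V0 n0 h0 by (simp add: R_def h_def a_def ln_div ln_mult ln_powr ln_realpow algebra_simps add_divide_distrib diff_divide_distrib)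
      have ln2: "ln (real n * (\<sigma>\<^sup>2 * V powr (1 / real r) / real n) powr (2 * real r / (2 * real r + 1)))
          = ln n + 2 * real r * a * (2 * ln \<sigma> + ln V / real r - ln n)"
        using \<sigma> V0 n0 by (simp add: a_def ln_div ln_mult ln_powr ln_realpow)
      have ra: "2 * real r * a = 1 - a" by (simp add: a_def field_simps)
      have "2 * real r * a * (2 * ln \<sigma> + ln V / real r - ln n)
          = 2 * ln \<sigma> * (2 * real r * a) + 2 * a * ln V - 2 * a * real r * ln n"
        using r by (simp add: field_simps)
      then have "2 * ln \<sigma> + ln n - 2 * a * (ln \<sigma> + real r * ln n - ln V) = ln n + 2 * real r * a * (2 * ln \<sigma> + ln V / real r - ln n)"
        unfolding ra by (simp add: algebra_simps)
      then show ?thesis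
        using ln1 ln2 \<sigma> V0 n0 h0 by (subst ln_inj_iff[symmetric]) (auto simp: R_def)
    qed
    have RM: "192 * real r * R \<le> 192 * real r * (real n * M)"
      unfolding R_rate M_def by (intro mult_left_mono) auto
    show ?thesis
    proof (cases "h < 1")
      case True
      have "?cost 0 \<le> 192 * real r * R"
      proof (rule cost_le)
        have "\<sigma>\<^sup>2 * real n / 1 \<le> R" unfolding R_def using True h0 \<sigma> n0
          by (intro divide_left_mono) auto
        moreover have "0 \<le> R" unfolding R_def using h0 by simp
        ultimately show "\<sigma>\<^sup>2 * real n / 2 ^ 0 \<le> 2 * R" by simp
      qed simp
      from order_trans[OF this RM] show ?thesis using n by (intro exI[of _ 0]) simp
    next
      case False
      then obtain s :: nat where s: "2 ^ s \<le> h" "h < 2 * 2 ^ s" using dyadic_floor[of h] by auto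
      have h_le_n_pow: "h powr (real r + 1 / 2) \<le> real n powr (real r + 1 / 2)"
      proof -
        have "\<sigma> * real n ^ r \<le> V * sqrt (real n) * real n ^ r"
          using \<open>\<not> V * sqrt (real n) \<le> \<sigma>\<close> by (intro mult_right_mono) auto
        then have "\<sigma> * real n ^ r / V \<le> real n ^ r * sqrt (real n)"
          using V0 by (simp add: field_simps)
        then show ?thesis unfolding h_pow using n0 by (simp add: powr_add powr_half_sqrt powr_realpow)
      qed
      have hn: "h \<le> real n"
        using powr_less_mono2[of "real r + 1 / 2" "real n" h] h_le_n_pow n0 by (force simp: not_le)
      have sn: "2 ^ s \<le> n"
        using order_trans[OF s(1) hn] by (metis of_nat_le_iff of_nat_numeral of_nat_power)
      have "?cost s \<le> 192 * real r * R"
      proof (rule cost_le)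
        have "\<sigma>\<^sup>2 * real n / 2 ^ s \<le> \<sigma>\<^sup>2 * real n / (h / 2)"
          using s h0 by (intro divide_left_mono) auto
        then show "\<sigma>\<^sup>2 * real n / 2 ^ s \<le> 2 * R" by (simp add: R_def mult_ac)
        have "sqrt (2 ^ s) * (2 ^ s) ^ (r - 1) \<le> h powr (real r - 1 / 2)"
          using s r by (subst half) (auto intro!: powr_mono2)
        then have "\<sigma> * (sqrt (2 ^ s) * (2 ^ s) ^ (r - 1)) * (V / real n ^ (r - 1))
            \<le> \<sigma> * h powr (real r - 1 / 2) * (V / real n ^ (r - 1))"
          using \<sigma> V by (intro mult_right_mono mult_left_mono) auto
        also have "h powr (real r - 1 / 2) = \<sigma> * real n ^ r / V / h"
        proof -
          have "h powr (real r - 1 / 2) = h powr (real r + 1 / 2 - 1)" by simp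
          also have "\<dots> = h powr (real r + 1 / 2) / h" using h0 by (simp only: powr_diff powr_one)
          finally show ?thesis by (simp add: h_pow)
        qed
        also have "\<sigma> * (\<sigma> * real n ^ r / V / h) * (V / real n ^ (r - 1)) = R"
        proof -
          have "real n ^ r = real n * real n ^ (r - 1)" using r by (cases r) auto
          then show ?thesis using V0 n0 by (simp add: R_def power2_eq_square)
        qed
        finally show "\<sigma> * (sqrt (2 ^ s) * (2 ^ s) ^ (r - 1)) * (V / real n ^ (r - 1)) \<le> R" .
      qed
      then show ?thesis using RM sn by (intro exI[of _ s]) simp
    qed
  qed
qed

section \<open>The risk bound\<close>

theorem theorem2p1:
  fixes r :: nat
  assumes "r \<ge> 1"
  shows "\<exists>C::real. C > 0 \<and>
    (\<forall>(n::nat) (\<sigma>::real) (\<theta>::nat \<Rightarrow> real) (V::real).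
       n \<ge> 2 * r \<longrightarrow> \<sigma> > 0 \<longrightarrow> \<theta> \<in> Rn n \<longrightarrow> V \<ge> 0 \<longrightarrow>
       real n ^ (r - 1) * Diff_norm1 n r \<theta> \<le> V \<longrightarrow>
       integrable (gaussian_vec n \<theta> \<sigma>) (\<lambda>Y. sq_dist n (trend_filter n r V Y) \<theta>) \<and>
       risk n \<sigma> (trend_filter n r V) \<theta>
         \<le> C * max ((\<sigma>\<^sup>2 * V powr (1 / real r) / real n) powr (2 * real r / (2 * real r + 1)))
                   (\<sigma>\<^sup>2 / real n * ln (exp 1 * real n)) \<and>
       (\<forall>x::real. x > 0 \<longrightarrow>
         measure (gaussian_vec n \<theta> \<sigma>)
           {Y \<in> space (gaussian_vec n \<theta> \<sigma>).
              1 / real n * sq_dist n (trend_filter n r V Y) \<theta>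
                \<le> C * max ((\<sigma>\<^sup>2 * V powr (1 / real r) / real n) powr (2 * real r / (2 * real r + 1)))
                          (\<sigma>\<^sup>2 / real n * ln (exp 1 * real n))
                  + 4 * \<sigma>\<^sup>2 * x / real n}
         \<ge> 1 - exp (- x)))"
proof (intro exI[of _ "192 * real r"] conjI allI impI)
  show "192 * real r > 0" using assms by simp
  fix n :: nat and \<sigma> :: real and \<theta> :: "nat \<Rightarrow> real" and V :: real
  assume n: "n \<ge> 2 * r" and \<sigma>: "\<sigma> > 0" and \<theta>: "\<theta> \<in> Rn n" and V: "V \<ge> 0"
    and D: "real n ^ (r - 1) * Diff_norm1 n r \<theta> \<le> V"
  let ?M = "max ((\<sigma>\<^sup>2 * V powr (1 / real r) / real n) powr (2 * real r / (2 * real r + 1)))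
                (\<sigma>\<^sup>2 / real n * ln (exp 1 * real n))"
  let ?F = "\<lambda>Y. sq_dist n (trend_filter n r V Y) \<theta>"
  let ?T = "192 * real r * (real n * ?M)"
  have n1: "1 \<le> n" using n assms by simp
  interpret prob_space "gaussian_vec n \<theta> \<sigma>" by (rule prob_space_gaussian_vec[OF \<sigma>])
  obtain s where s: "2 ^ s \<le> n" "48 * real r * \<sigma>\<^sup>2 * real n / 2 ^ s
      + (if s = 0 then 0 else 96 * \<sigma> * real r * sqrt (2 ^ s) * (2 ^ s) ^ (r - 1) * (V / real n ^ (r - 1))) \<le> ?T"
    using scale_selection[OF assms n1 \<sigma> V] by blast
  have n0: "0 < n" using n1 by simp
  note mgf = exp_moment_trend_filter[OF assms n0 \<sigma> \<theta> D s]
  have meas: "?F \<in> borel_measurable (gaussian_vec n \<theta> \<sigma>)"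
    by (rule sq_dist_trend_filter_measurable) (use mgf(2) in auto)
  have nonneg: "0 \<le> ?F Y" for Y by (simp add: sq_dist_def)
  have c: "0 < 4 * \<sigma>\<^sup>2" using \<sigma> by simp
  note conseq = exp_moment_consequences[OF meas nonneg c mgf(1)]
  show "integrable (gaussian_vec n \<theta> \<sigma>) ?F" by (rule conseq(1))
  show "risk n \<sigma> (trend_filter n r V) \<theta> \<le> 192 * real r * ?M"
    using conseq(2) n1 unfolding risk_def by (simp add: field_simps)
  fix x :: real assume "x > 0"
  have "{Y \<in> space (gaussian_vec n \<theta> \<sigma>). 1 / real n * ?F Y \<le> 192 * real r * ?M + 4 * \<sigma>\<^sup>2 * x / real n}
      = {Y \<in> space (gaussian_vec n \<theta> \<sigma>). ?F Y \<le> ?T + 4 * \<sigma>\<^sup>2 * x}"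
    using n1 by (intro Collect_cong conj_cong refl) (simp add: field_simps)
  then show "measure (gaussian_vec n \<theta> \<sigma>)
      {Y \<in> space (gaussian_vec n \<theta> \<sigma>). 1 / real n * ?F Y \<le> 192 * real r * ?M + 4 * \<sigma>\<^sup>2 * x / real n}
      \<ge> 1 - exp (- x)"
    using conseq(3)[of x] by simp
qed

end
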